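(* Let $n\ge 1$, let $K,L\in\mathcal{K}^n_0$, let $p,q\in[-\infty,\infty]$, and let $M_p\in\{\overline{M}_p,\underline{M}_p\}$, $M_q\in\{\overline{M}_q,\underline{M}_q\}$. (i) If $(M_p,M_q)\ne(\overline{M}_p,\underline{M}_q)$ and $p\ge q$, then \[ R_0(M_p(K,L),M_q(K,L))=\frac{m_p(R_0^{\max}(K,L),1)}{m_q(R_0^{\max}(K,L),1)}. \] (ii) If $(M_p,M_q)\neq(\overline{M}_p,\underline{M}_q)$ and $p<q$, then \[ R_0(M_p(K,L),M_q(K,L))\le 1. \] (iii) If $(p,q)\notin(1,\infty)\times(-\infty,-1)$, then \[ R_0(\overline{M}_p(K,L),\underline{M}_q(K,L))\le\min\{m_p(R_0^{\max}(K,L),1),\,m_{-q}(R_0^{\max}(K,L),1)\}. \] (iv) If $(p,q)\in(1,\infty)\times(-\infty,-1)$, then \[ R_0(\overline{M}_p(K,L),\underline{M}_q(K,L))\le 2^{\frac1q-\frac1p}\,R_0\left(\begin{pmatrix}R_0^{\max}(K,L)&1\\1&R_0^{\max}(K,L)\end{pmatrix}\mathbb{B}^2_{\frac{p}{p-1}},\ \mathbb{B}^2_{-q}\right). \] If moreover $\frac{p}{p-1}\ge -q$, then the right-hand side is equal to $m_1(R_0^{\max}(K,L),1)=\frac{R_0^{\max}(K,L)+1}{2}$. For any of these inequalities, excluding (possibly) the case $(p,q)\in(-\infty,1)\times(-1,\infty)$ for (iii), there exists for every $n\ge2$ and $R\ge1$ a body $K\in\mathcal{K}^n_0$ such that $R=R_0^{\max}(K,-K)$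 and equality is attained for the choice $L=-K$.
   Context: $\mathcal{K}^n_0$ denotes the set of compact convex subsets of $\mathbb{R}^n$ containing the origin in their interior. For $C\in\mathcal{K}^n_0$, $h_C(a)=\sup\{a^Tx : x\in C\}$ is the support function and $\|x\|_C=\inf\{\lambda\ge 0 : x\in\lambda C\}$ the gauge function. For $x,y>0$, $m_p(x,y)=\left(\frac{x^p+y^p}{2}\right)^{1/p}$ if $p\in\mathbb{R}\setminus\{0\}$, $m_0(x,y)=\sqrt{xy}$, $m_{-\infty}(x,y)=\min\{x,y\}$, $m_\infty(x,y)=\max\{x,y\}$. $\mathbb{S}_2$ is the Euclidean unit sphere in $\mathbb{R}^n$. For $K,L\in\mathcal{K}^n_0$ and $p\in[-\infty,\infty]$, the upper $p$-mean is \[ \overline{M}_p(K,L)=\{x\in\mathbb{R}^n : a^Tx\le m_p(h_K(a),h_L(a)) \text{ for all } a\in\mathbb{S}_2\}, \] and the lower $p$-mean is \[ \underline{M}_p(K,L)=\mathrm{conv}\left(\left\{m_p(\|v\|_K^{-1},\|v\|_L^{-1})\,v : v\in\mathbb{S}_2\right\}\right). \] The covering radius of $X$ with respect to $Y$ is $R_0(X,Y)=\inf\{\lambda\ge0 : X\subset\lambda Y\}$, and the covering distance is $R_0^{\max}(X,Y)=\max\{R_0(X,Y),R_0(Y,X)\}$. For $r\ge1$, $\mathbb{B}^2_r\subset\mathbb{R}^2$ is the closed unit ball of the $r$-norm; for a matrix $A$ and a set $X$, $AX=\{Ax : x\in X\}$; $-K=\{-x : x\in K\}$. The condition $(M_p,M_q)\ne(\overline{M}_p,\underline{M}_q)$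 means that the choice "upper mean for $p$ together with lower mean for $q$" is excluded. *)

theory Defs
  imports "HOL-Analysis.Analysis"
begin

definition bodies0 :: "(real ^ 'n) set set" where
  "bodies0 = {K. compact K \<and> convex K \<and> 0 \<in> interior K}"

definition support_fn :: "(real ^ 'n) set \<Rightarrow> real ^ 'n \<Rightarrow> real" where
  "support_fn C a = (SUP x\<in>C. a \<bullet> x)"

definition gauge_fn :: "(real ^ 'n) set \<Rightarrow> real ^ 'n \<Rightarrow> real" where
  "gauge_fn C x = Inf {l. 0 \<le> l \<and> x \<in> (*\<^sub>R) l ` C}"

text \<open>The power mean is meant for positive arguments only.\<close>

definition pmean :: "ereal \<Rightarrow> real \<Rightarrow> real \<Rightarrow> real" where
  "pmean p x y =
    (if p = \<infinity> then max x y
     else if p = -\<infinity> then min x y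
     else if p = 0 then sqrt (x * y)
     else ((x powr real_of_ereal p + y powr real_of_ereal p) / 2) powr (1 / real_of_ereal p))"

definition upper_mean :: "ereal \<Rightarrow> (real ^ 'n) set \<Rightarrow> (real ^ 'n) set \<Rightarrow> (real ^ 'n) set" where
  "upper_mean p K L =
    {x. \<forall>a\<in>sphere 0 1. a \<bullet> x \<le> pmean p (support_fn K a) (support_fn L a)}"

definition lower_mean :: "ereal \<Rightarrow> (real ^ 'n) set \<Rightarrow> (real ^ 'n) set \<Rightarrow> (real ^ 'n) set" where
  "lower_mean p K L =
    convex hull ((\<lambda>v. pmean p (inverse (gauge_fn K v)) (inverse (gauge_fn L v)) *\<^sub>R v) ` sphere 0 1)"

text \<open>The choice of \<open>M\<^sub>p\<close> between the two means is syntactic: the excluded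
  combination of choices must not be read as an inequality between the resulting sets.\<close>

datatype mean_kind = Upper | Lower

fun mean_of :: "mean_kind \<Rightarrow> ereal \<Rightarrow> (real ^ 'n) set \<Rightarrow> (real ^ 'n) set \<Rightarrow> (real ^ 'n) set" where
  "mean_of Upper p K L = upper_mean p K L"
| "mean_of Lower p K L = lower_mean p K L"

text \<open>The infimum is real-valued. This is adequate when \<open>X\<close> is bounded and \<open>0\<close> is an interior
  point of \<open>Y\<close>, since some multiple of \<open>Y\<close> then covers \<open>X\<close>.\<close>

definition covering_radius :: "(real ^ 'n) set \<Rightarrow> (real ^ 'n) set \<Rightarrow> real" where
  "covering_radius X Y = Inf {l. 0 \<le> l \<and> X \<subseteq> (*\<^sub>R) l ` Y}"

definition covering_distance :: "(real ^ 'n) set \<Rightarrow> (real ^ 'n) set \<Rightarrow> real" where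
  "covering_distance X Y = max (covering_radius X Y) (covering_radius Y X)"

definition unit_ball2 :: "real \<Rightarrow> (real ^ 2) set" where
  "unit_ball2 r = {x. (\<bar>x $ 1\<bar> powr r + \<bar>x $ 2\<bar> powr r) powr (1 / r) \<le> 1}"

text \<open>The right-hand side of the bound for an upper \<open>P\<close>-mean and a lower \<open>Q\<close>-mean with
  \<open>P > 1\<close> and \<open>Q < -1\<close>, at covering distance \<open>R\<close>.\<close>

definition matrix_bound :: "real \<Rightarrow> real \<Rightarrow> real \<Rightarrow> real" where
  "matrix_bound P Q R =
    2 powr (1 / Q - 1 / P) *
    covering_radius
      ((*v) (vector [vector [R, 1], vector [1, R]] :: real ^ 2 ^ 2) ` unit_ball2 (P / (P - 1)))
      (unit_ball2 (- Q))"

end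

theory Submission
  imports Defs
begin

text \<open>Write \<open>R\<close> for the covering distance, so that \<open>R \<ge> 1\<close> is the least number with \<open>K \<subseteq> R L\<close> and
\<open>L \<subseteq> R K\<close>. Both gauges and both support functions then differ by a factor at most \<open>R\<close>, in either
direction. Everything rests on one property of power means: for \<open>p \<ge> q\<close> the quotient
\<open>m\<^sub>p(x, 1) / m\<^sub>q(x, 1)\<close> increases with \<open>x \<ge> 1\<close> (\<open>pmean_ratio_mono\<close>), hence
\<open>m\<^sub>p \<le> (m\<^sub>p(R, 1) / m\<^sub>q(R, 1)) m\<^sub>q\<close> on all pairs with ratio at most \<open>R\<close> (\<open>pmean_le_ratio\<close>).

Applied to support functions this compares upper means. A lower mean is handled through gauges,
because \<open>m\<^sub>p(1/x, 1/y) = 1 / m\<^sub>-\<^sub>p(x, y)\<close>: it is the convex hull of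
\<open>{x. m\<^sub>-\<^sub>p(\<parallel>x\<parallel>\<^sub>K, \<parallel>x\<parallel>\<^sub>L) \<le> 1}\<close> (\<open>lower_mean_intro\<close>, \<open>lower_mean_subset\<close>). The comparison is exact
because the boundaries of \<open>K\<close> and \<open>R L\<close>, say, share a point with a common normal
(\<open>touching_point\<close>), and there every mean is given by the power mean of \<open>R\<close> and \<open>1\<close>, up to a common factor.

For an upper mean against a lower mean, either the upper mean lies in \<open>m\<^sub>p(R, 1) K\<close> and in
\<open>m\<^sub>p(R, 1) L\<close>, or it lies in the convex hull of \<open>K \<union> L\<close>, each point of \<open>K\<close> and \<open>L\<close> being in
\<open>m\<^sub>-\<^sub>q(R, 1)\<close> times the lower mean. When \<open>p > 1\<close> and \<open>q < -1\<close>, Hoelder duality does better: the norm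
\<open>\<parallel>(\<parallel>x\<parallel>\<^sub>K, \<parallel>x\<parallel>\<^sub>L)\<parallel>\<close> with exponent \<open>-q\<close> is a value \<open>(\<alpha> a + \<beta> b) \<bullet> x\<close>, where \<open>a\<close> and \<open>b\<close> are bounded by \<open>1\<close> on
\<open>K\<close> and \<open>L\<close>; such a functional is bounded by \<open>\<alpha> + R \<beta>\<close> on \<open>K\<close> and by \<open>R \<alpha> + \<beta>\<close> on \<open>L\<close>, and a second
duality turns this into the norm of the matrix with rows \<open>(R, 1)\<close> and \<open>(1, R)\<close>
(\<open>upper_lower_radius_le_matrix_bound\<close>).

For sharpness, a box that is long in the negative \<open>i\<close>-th and in the positive \<open>j\<close>-th direction
contains the point with these coordinates equal to \<open>(1, R)\<close>, and its reflection the one with \<open>(R, 1)\<close>;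
combinations of the two have the largest possible gauges. The prism over the polar quadrilateral
plays the same role for \<open>p \<ge> 1\<close> and \<open>q \<ge> -1\<close>. Where the bound is \<open>1\<close>, a body sharing a supporting slab with its reflection suffices.\<close>

section \<open>Power means of two numbers\<close>

lemma pmean_infty [simp]: "pmean \<infinity> x y = max x y" "pmean (-\<infinity>) x y = min x y"
  by (simp_all add: pmean_def)

lemma pmean_ereal:
  "pmean (ereal r) x y =
    (if r = 0 then sqrt (x * y) else ((x powr r + y powr r) / 2) powr (1 / r))"
  by (simp add: pmean_def zero_ereal_def)

lemma pmean_one: "0 < x \<Longrightarrow> 0 < y \<Longrightarrow> pmean 1 x y = (x + y) / 2"
  by (simp add: one_ereal_def pmean_ereal)

lemma pmean_pos: "0 < x \<Longrightarrow> 0 < y \<Longrightarrow> 0 < pmean p x y"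
proof (cases p)
  case (real r)
  assume "0 < x" "0 < y"
  then have "x powr r + y powr r > 0" by (simp add: add_pos_pos)
  then show ?thesis using \<open>0 < x\<close> \<open>0 < y\<close> real by (simp add: pmean_ereal)
qed simp_all

lemma pmean_commute: "pmean p x y = pmean p y x"
  by (simp add: pmean_def add.commute mult.commute max.commute min.commute)

lemma pmean_same: "0 < x \<Longrightarrow> pmean p x x = x"
  by (cases p) (simp_all add: pmean_ereal powr_powr)

lemma pmean_scale:
  assumes "0 < c" "0 < x" "0 < y"
  shows "pmean p (c * x) (c * y) = c * pmean p x y"
proof (cases p)
  case (real r)
  have sum: "((c * x) powr r + (c * y) powr r) / 2 = c powr r * ((x powr r + y powr r) / 2)"
    using assms by (simp add: powr_mult algebra_simps)
  moreover have "sqrt (c * x * (c * y)) = c * sqrt (x * y)"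
    using assms by (simp add: real_sqrt_mult algebra_simps)
  moreover have "(c powr r * ((x powr r + y powr r) / 2)) powr (1 / r)
      = c * ((x powr r + y powr r) / 2) powr (1 / r)" if "r \<noteq> 0"
    using that assms by (subst powr_mult) (simp_all add: powr_powr)
  ultimately show ?thesis using real unfolding real pmean_ereal sum by simp
qed (use assms in \<open>simp_all add: max_def min_def\<close>)

lemma pmean_mono:
  assumes "0 < x" "0 < y" "x \<le> x'" "y \<le> y'"
  shows "pmean p x y \<le> pmean p x' y'"
proof (cases p)
  case (real r)
  consider "r = 0" | "0 < r" | "r < 0" by linarith
  then show ?thesis
  proof cases
    case 1
    then show ?thesis using real assms by (auto simp: pmean_ereal intro!: mult_mono)
  next
    case 2
    then show ?thesis using real assms
      by (auto simp: pmean_ereal intro!: powr_mono2 add_mono divide_right_mono)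
  next
    case 3
    have "0 < x' powr r + y' powr r" using assms by (simp add: add_pos_pos)
    moreover have "x' powr r + y' powr r \<le> x powr r + y powr r"
      using 3 assms by (intro add_mono powr_mono2') simp_all
    ultimately have "((x powr r + y powr r) / 2) powr (1 / r) \<le> ((x' powr r + y' powr r) / 2) powr (1 / r)"
      using 3 by (intro powr_mono2') simp_all
    with 3 real show ?thesis by (simp add: pmean_ereal)
  qed
next
  case PInf
  then show ?thesis using assms(3,4) by (simp only: pmean_infty max.mono)
next
  case MInf
  then show ?thesis using assms(3,4) by (simp only: pmean_infty min.mono)
qed

text \<open>The duality behind lower means: it trades radial functions for gauges at the price of changing the
sign of the exponent.\<close>

lemma pmean_inverse:
  assumes "0 < x" "0 < y"
  shows "pmean p (inverse x) (inverse y) = inverse (pmean (- p) x y)"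
proof (cases p)
  case (real r)
  have *: "inverse z powr r = z powr (- r)" if "z > 0" for z
    using that by (simp add: powr_minus inverse_powr)
  have "((x powr (- r) + y powr (- r)) / 2) powr (1 / r)
      = inverse (((x powr (- r) + y powr (- r)) / 2) powr (- (1 / r)))"
    by (simp add: powr_minus)
  with real show ?thesis using *[OF assms(1)] *[OF assms(2)] assms
    by (simp_all add: pmean_ereal real_sqrt_mult real_sqrt_inverse mult.commute)
qed (use assms in \<open>simp_all add: max_def min_def\<close>)

text \<open>On \<open>t \<ge> 0\<close> this is \<open>ln (pmean p (exp t) 1)\<close>. For infinite \<open>p\<close> the branch valid on \<open>t \<ge> 0\<close> is used on
the whole line, so that the function has a derivative at \<open>0\<close> as well.\<close>

definition log_pmean :: "ereal \<Rightarrow> real \<Rightarrow> real" where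
  "log_pmean p t =
    (if p = \<infinity> then t else if p = -\<infinity> then 0 else if p = 0 then t / 2
     else ln ((exp (real_of_ereal p * t) + 1) / 2) / real_of_ereal p)"

definition log_pmean_slope :: "ereal \<Rightarrow> real \<Rightarrow> real" where
  "log_pmean_slope p t =
    (if p = \<infinity> then 1 else if p = -\<infinity> then 0 else 1 / (1 + exp (- (real_of_ereal p * t))))"

lemma pmean_exp:
  assumes "0 \<le> t"
  shows "pmean p (exp t) 1 = exp (log_pmean p t)"
proof (cases p)
  case (real r)
  have pos: "0 < (exp (r * t) + 1) / 2" by (simp add: add_pos_pos)
  have "exp t powr r = exp (r * t)" by (simp add: powr_def)
  moreover have "sqrt (exp t) = exp (t / 2)"
    by (rule real_sqrt_unique) (simp_all add: power2_eq_square flip: exp_add)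
  ultimately show ?thesis using real pos
    by (simp_all add: pmean_ereal log_pmean_def zero_ereal_def powr_def)
qed (use assms in \<open>simp_all add: log_pmean_def\<close>)

lemma log_pmean_deriv: "(log_pmean p has_real_derivative log_pmean_slope p t) (at t)"
proof (cases p)
  case (real r)
  show ?thesis
  proof (cases "r = 0")
    case True
    then have "log_pmean p = (\<lambda>t. t / 2)" "log_pmean_slope p t = 1 / 2"
      using real by (simp_all add: log_pmean_def log_pmean_slope_def zero_ereal_def fun_eq_iff)
    then show ?thesis by (auto intro!: derivative_eq_intros)
  next
    case False
    have eq: "log_pmean p = (\<lambda>t. ln ((exp (r * t) + 1) / 2) / r)"
      using real False by (simp_all add: log_pmean_def zero_ereal_def fun_eq_iff)
    have pos: "exp (r * t) + 1 > 0" by (simp add: add_pos_pos)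
    have "1 / (1 + exp (- (r * t))) = exp (r * t) / (exp (r * t) + 1)"
      using pos by (simp add: exp_minus field_simps)
    then have slope: "log_pmean_slope p t = exp (r * t) / (exp (r * t) + 1)"
      using real by (simp add: log_pmean_slope_def)
    have "((\<lambda>t. ln ((exp (r * t) + 1) / 2) / r) has_real_derivative
        (1 / ((exp (r * t) + 1) / 2) * (exp (r * t) * r / 2)) / r) (at t)"
      using False pos by (auto intro!: derivative_eq_intros)
    also have "(1 / ((exp (r * t) + 1) / 2) * (exp (r * t) * r / 2)) / r = log_pmean_slope p t"
      unfolding slope using False pos by (simp add: divide_simps)
    finally show ?thesis unfolding eq .
  qed
next
  case PInf
  then have "log_pmean p = (\<lambda>t. t)" "log_pmean_slope p t = 1"
    by (simp_all add: log_pmean_def log_pmean_slope_def fun_eq_iff)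
  then show ?thesis by simp
next
  case MInf
  then have "log_pmean p = (\<lambda>t. 0)" "log_pmean_slope p t = 0"
    by (simp_all add: log_pmean_def log_pmean_slope_def fun_eq_iff)
  then show ?thesis by simp
qed

text \<open>For finite \<open>p\<close> the slope at \<open>t\<close> is the weight \<open>x\<^sup>p / (x\<^sup>p + 1)\<close> of \<open>x = exp t \<ge> 1\<close> in the mean; a larger exponent
puts more weight on the larger argument.\<close>

lemma log_pmean_slope_mono:
  assumes "q \<le> p" "0 \<le> t"
  shows "log_pmean_slope q t \<le> log_pmean_slope p t"
proof -
  have "1 / (1 + exp (- (s * t))) \<le> 1 / (1 + exp (- (r * t)))" if "s \<le> r" for r s
    using that assms(2)
    by (intro divide_left_mono) (auto intro!: mult_right_mono mult_pos_pos add_pos_pos)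
  moreover have "0 \<le> 1 / (1 + exp (- (r * t)))" "1 / (1 + exp (- (r * t))) \<le> 1" for r
    by (simp_all add: field_simps add_pos_pos)
  ultimately show ?thesis using assms(1)
    by (cases p; cases q) (simp_all add: log_pmean_slope_def)
qed

lemma log_pmean_diff_mono:
  assumes "q \<le> p" "0 \<le> t" "t \<le> u"
  shows "log_pmean p t - log_pmean q t \<le> log_pmean p u - log_pmean q u"
proof (rule DERIV_nonneg_imp_nondecreasing[OF assms(3)])
  fix x assume "t \<le> x" "x \<le> u"
  then show "\<exists>y. ((\<lambda>x. log_pmean p x - log_pmean q x) has_real_derivative y) (at x) \<and> 0 \<le> y"
    using assms log_pmean_slope_mono[of q p x]
    by (intro exI[of _ "log_pmean_slope p x - log_pmean_slope q x"])
       (auto intro!: derivative_intros log_pmean_deriv)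
qed

text \<open>In the variable \<open>t = ln x\<close>, the logarithm of the quotient has the nonnegative derivative
\<open>log_pmean_slope p t - log_pmean_slope q t\<close>.\<close>

lemma pmean_ratio_mono:
  assumes "q \<le> p" "1 \<le> x" "x \<le> y"
  shows "pmean p x 1 / pmean q x 1 \<le> pmean p y 1 / pmean q y 1"
proof -
  have "pmean p z 1 / pmean q z 1 = exp (log_pmean p (ln z) - log_pmean q (ln z))" if "1 \<le> z" for z
    using that pmean_exp[of "ln z"] by (simp add: exp_diff)
  then show ?thesis using log_pmean_diff_mono[of q p "ln x" "ln y"] assms by simp
qed

text \<open>By homogeneity and symmetry the quotient of the two means depends only on the ratio of the larger
to the smaller argument, and this ratio lies between \<open>1\<close> and \<open>R\<close>.\<close>

lemma pmean_le_ratio: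
  assumes "q \<le> p" "0 < x" "0 < y" "x \<le> R * y" "y \<le> R * x"
  shows "pmean p x y \<le> pmean p R 1 / pmean q R 1 * pmean q x y"
  using assms(2-)
proof (induction x y rule: linorder_wlog)
  case (le x y)
  have r: "1 \<le> y / x" "y / x \<le> R" using le by (simp_all add: field_simps)
  have h: "pmean s x y = x * pmean s (y / x) 1" for s
    using pmean_scale[of x "y / x" 1 s] le by (simp add: pmean_commute)
  have "0 < pmean q (y / x) 1" using le by (intro pmean_pos) simp_all
  then have "pmean p (y / x) 1 \<le> pmean p R 1 / pmean q R 1 * pmean q (y / x) 1"
    using pmean_ratio_mono[OF assms(1) r] by (simp only: pos_divide_le_eq)
  then have "x * pmean p (y / x) 1 \<le> x * (pmean p R 1 / pmean q R 1 * pmean q (y / x) 1)"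
    using le(2) by (intro mult_left_mono) simp_all
  then show ?case unfolding h by (simp only: mult.left_commute)
next
  case (sym x y)
  then show ?case by (simp add: pmean_commute)
qed

text \<open>The quotient of the means starts at the value \<open>1\<close> for equal arguments and increases from there.\<close>

lemma pmean_mono_exponent:
  assumes "q \<le> p" "0 < x" "0 < y"
  shows "pmean q x y \<le> pmean p x y"
  using assms(2-)
proof (induction x y rule: linorder_wlog)
  case (le x y)
  have h: "pmean s x y = x * pmean s (y / x) 1" for s
    using pmean_scale[of x "y / x" 1 s] le by (simp add: pmean_commute)
  have "0 < pmean q (y / x) 1" using le by (intro pmean_pos) simp_all
  then show ?case
    using pmean_ratio_mono[OF assms(1), of 1 "y / x"] le unfolding h by (simp add: pmean_same)
next
  case (sym x y)
  then show ?case by (simp add: pmean_commute)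
qed

text \<open>Hence \<open>m\<^sub>-\<^sub>q(R, 1) / m\<^sub>-\<^sub>p(R, 1) = m\<^sub>p(R, 1) / m\<^sub>q(R, 1)\<close>: gauges and support functions lead to the same
constant.\<close>

lemma pmean_uminus_R:
  assumes "0 < R"
  shows "pmean (- p) R 1 = R / pmean p R 1"
proof -
  have "pmean p 1 (inverse R) = inverse (pmean (- p) R 1)"
    using assms pmean_inverse[of R 1 p] by (simp add: pmean_commute)
  moreover have "pmean p R 1 = R * pmean p 1 (inverse R)"
    using pmean_scale[of R 1 "inverse R" p] assms by simp
  ultimately show ?thesis using assms by (simp add: divide_inverse)
qed

lemma pmean_bounds:
  assumes "0 < x" "0 < y"
  shows "min x y \<le> pmean p x y" "pmean p x y \<le> max x y"
  using pmean_mono_exponent[of "-\<infinity>" p x y] pmean_mono_exponent[of p "\<infinity>" x y] assms by simp_all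

section \<open>Gauges, support functions and covering radii\<close>

lemma bodies0D:
  assumes "K \<in> bodies0"
  shows "compact K" "convex K" "closed K" "bounded K" "0 \<in> K"
  using assms interior_subset by (auto simp: bodies0_def compact_imp_closed compact_imp_bounded)

lemma bodies0_ball: "K \<in> bodies0 \<Longrightarrow> \<exists>e>0. cball 0 e \<subseteq> K"
  by (simp_all add: bodies0_def mem_interior_cball)

lemma mem_scaleR_image_iff: "0 < c \<Longrightarrow> x \<in> (*\<^sub>R) c ` S \<longleftrightarrow> (1 / c) *\<^sub>R x \<in> S"
  for x :: "'a :: real_vector"
  by (auto intro: rev_image_eqI[of "(1 / c) *\<^sub>R x"])

lemma bounded_normE:
  assumes "bounded X"
  obtains B where "0 < B" "\<And>x. x \<in> X \<Longrightarrow> norm x \<le> B"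
  using assms by (auto simp: bounded_pos)

lemma scaleR_image_mono:
  fixes S :: "'a :: real_vector set"
  assumes "convex S" "0 \<in> S" "0 \<le> l" "l \<le> m"
  shows "(*\<^sub>R) l ` S \<subseteq> (*\<^sub>R) m ` S"
proof (cases "m = 0")
  case False
  show ?thesis
  proof clarify
    fix x assume "x \<in> S"
    then have "(1 - l / m) *\<^sub>R 0 + (l / m) *\<^sub>R x \<in> S"
      using assms False by (intro convexD) simp_all
    then have "m *\<^sub>R ((l / m) *\<^sub>R x) \<in> (*\<^sub>R) m ` S" by (intro imageI) simp
    moreover have "m *\<^sub>R ((l / m) *\<^sub>R x) = l *\<^sub>R x" using False by simp
    ultimately show "l *\<^sub>R x \<in> (*\<^sub>R) m ` S" by metis
  qed
qed (use assms in simp_all)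

lemma covering_radius_le: "0 \<le> c \<Longrightarrow> X \<subseteq> (*\<^sub>R) c ` Y \<Longrightarrow> covering_radius X Y \<le> c"
  unfolding covering_radius_def by (rule cInf_lower) (auto intro: bdd_belowI[of _ 0])

text \<open>Some covering factor has to be exhibited, since the infimum of the empty set of reals carries no
information.\<close>

lemma covering_radius_ge:
  assumes "0 \<le> c" "X \<subseteq> (*\<^sub>R) c ` Y"
    and "\<And>l. 0 \<le> l \<Longrightarrow> X \<subseteq> (*\<^sub>R) l ` Y \<Longrightarrow> b \<le> l"
  shows "b \<le> covering_radius X Y"
  unfolding covering_radius_def using assms by (intro cInf_greatest) auto

lemma covering_radius_eq:
  assumes "0 \<le> c" "X \<subseteq> (*\<^sub>R) c ` Y"
    and "\<And>l. 0 \<le> l \<Longrightarrow> X \<subseteq> (*\<^sub>R) l ` Y \<Longrightarrow> c \<le> l"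
  shows "covering_radius X Y = c"
  using covering_radius_le covering_radius_ge assms by (metis antisym)

lemma body_absorbs:
  fixes L :: "(real ^ 'n) set"
  assumes "L \<in> bodies0" "bounded X"
  shows "\<exists>l>0. X \<subseteq> (*\<^sub>R) l ` L"
proof -
  obtain e where e: "e > 0" "cball 0 e \<subseteq> L" using bodies0_ball assms(1) by blast
  obtain B where B: "B > 0" "\<And>x. x \<in> X \<Longrightarrow> norm x \<le> B"
    by (rule bounded_normE[OF assms(2)]) (rule that)
  have "x \<in> (*\<^sub>R) (B / e) ` L" if "x \<in> X" for x
  proof -
    have "norm ((1 / (B / e)) *\<^sub>R x) \<le> e" using B(1) B(2)[OF that] e(1) by (simp add: field_simps)
    then show ?thesis using e B(1) by (subst mem_scaleR_image_iff) auto
  qed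
  then show ?thesis using B e by (intro exI[of _ "B / e"]) auto
qed

lemma gauge_le: "0 \<le> l \<Longrightarrow> x \<in> (*\<^sub>R) l ` K \<Longrightarrow> gauge_fn K x \<le> l"
  unfolding gauge_fn_def by (rule cInf_lower) (auto intro: bdd_belowI[of _ 0])

lemma gauge_set_nonempty:
  fixes K :: "(real ^ 'n) set"
  assumes "K \<in> bodies0"
  shows "{l. 0 \<le> l \<and> x \<in> (*\<^sub>R) l ` K} \<noteq> {}"
proof -
  obtain l where "0 < l" "{x} \<subseteq> (*\<^sub>R) l ` K" using body_absorbs[OF assms, of "{x}"] by auto
  then have "0 \<le> l \<and> x \<in> (*\<^sub>R) l ` K" by simp
  then show ?thesis by blast
qed

lemma gauge_nonneg:
  fixes K :: "(real ^ 'n) set"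
  assumes "K \<in> bodies0"
  shows "0 \<le> gauge_fn K x"
  unfolding gauge_fn_def using gauge_set_nonempty[OF assms] by (intro cInf_greatest) simp_all

text \<open>The infimum in the gauge is attained. If it is positive this is closedness of \<open>K\<close>; if it is \<open>0\<close>,
boundedness of \<open>K\<close> forces \<open>x = 0\<close>.\<close>

lemma gauge_mem:
  fixes K :: "(real ^ 'n) set"
  assumes K: "K \<in> bodies0"
  shows "x \<in> (*\<^sub>R) (gauge_fn K x) ` K"
proof -
  define g where "g = gauge_fn K x"
  have g0: "0 \<le> g" using gauge_nonneg[OF K] by (simp add: g_def)
  have above: "(1 / m) *\<^sub>R x \<in> K" if m: "g < m" for m
  proof -
    obtain l where l: "0 \<le> l" "x \<in> (*\<^sub>R) l ` K" "l < m"
      using cInf_lessD[OF gauge_set_nonempty[OF K] m[unfolded g_def gauge_fn_def]] by auto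
    then have "x \<in> (*\<^sub>R) m ` K"
      using scaleR_image_mono[of K l m] bodies0D[OF K] by auto
    then show ?thesis using l by (subst (asm) mem_scaleR_image_iff) simp_all
  qed
  show ?thesis
  proof (cases "g = 0")
    case True
    obtain B where B: "B > 0" "\<And>y. y \<in> K \<Longrightarrow> norm y \<le> B"
      by (rule bounded_normE[OF bodies0D(4)[OF K]]) (rule that)
    have "x = 0"
    proof (rule ccontr)
      assume "x \<noteq> 0"
      then have m: "0 < norm x / (2 * B)" using B by simp
      have "norm ((1 / (norm x / (2 * B))) *\<^sub>R x) \<le> B"
        using above[of "norm x / (2 * B)"] m True B(2) by blast
      then show False using \<open>x \<noteq> 0\<close> B by simp
    qed
    then show ?thesis using True bodies0D(5)[OF K] by (auto simp: g_def image_iff)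
  next
    case False
    then have g: "0 < g" using g0 by simp
    have lim: "(\<lambda>n. (1 / (g + inverse (real (Suc n)))) *\<^sub>R x) \<longlonglongrightarrow> (1 / (g + 0)) *\<^sub>R x"
      using g by (intro tendsto_intros LIMSEQ_inverse_real_of_nat) simp_all
    have mem: "(1 / (g + inverse (real (Suc n)))) *\<^sub>R x \<in> K" for n
      by (rule above) simp
    have "(1 / (g + 0)) *\<^sub>R x \<in> K"
      by (rule closed_sequentially[OF bodies0D(3)[OF K] _ lim]) (rule mem)
    then show ?thesis using g by (simp add: mem_scaleR_image_iff g_def)
  qed
qed

lemma gauge_pos:
  fixes K :: "(real ^ 'n) set"
  assumes "K \<in> bodies0" "x \<noteq> 0"
  shows "0 < gauge_fn K x"
proof -
  have "gauge_fn K x \<noteq> 0" using gauge_mem[OF assms(1), of x] assms(2) by auto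
  then show ?thesis using gauge_nonneg[OF assms(1), of x] by simp
qed

lemma gauge_le_one: "x \<in> K \<Longrightarrow> gauge_fn K x \<le> 1"
  by (rule gauge_le) simp_all

lemma gauge_le_if_scaled: "0 < l \<Longrightarrow> (1 / l) *\<^sub>R x \<in> K \<Longrightarrow> gauge_fn K x \<le> l"
  by (rule gauge_le) (simp_all add: mem_scaleR_image_iff)

lemma gauge_scale:
  fixes K :: "(real ^ 'n) set"
  assumes K: "K \<in> bodies0" and c: "0 < c"
  shows "gauge_fn K (c *\<^sub>R x) = c * gauge_fn K x"
proof -
  have le: "gauge_fn K (c *\<^sub>R x) \<le> c * gauge_fn K x" if "0 < c" for c x
  proof -
    obtain y where "y \<in> K" "x = gauge_fn K x *\<^sub>R y" using gauge_mem[OF K, of x] by auto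
    then have "c *\<^sub>R x = (c * gauge_fn K x) *\<^sub>R y" by (metis scaleR_scaleR)
    then show ?thesis using \<open>y \<in> K\<close> that gauge_nonneg[OF K, of x] by (intro gauge_le) auto
  qed
  have "gauge_fn K x \<le> (1 / c) * gauge_fn K (c *\<^sub>R x)"
    using le[of "1 / c" "c *\<^sub>R x"] c by simp
  then show ?thesis using le[OF c, of x] c by (simp add: field_simps)
qed

lemma inner_le_gauge:
  fixes K :: "(real ^ 'n) set"
  assumes K: "K \<in> bodies0" and "\<And>y. y \<in> K \<Longrightarrow> a \<bullet> y \<le> b"
  shows "a \<bullet> x \<le> b * gauge_fn K x"
proof -
  obtain y where y: "y \<in> K" "x = gauge_fn K x *\<^sub>R y" using gauge_mem[OF K, of x] by auto
  have "a \<bullet> x = gauge_fn K x * (a \<bullet> y)" by (subst y(2)) simp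
  then show ?thesis
    using assms(2)[OF y(1)] gauge_nonneg[OF K, of x] by (simp add: mult.commute[of b] mult_left_mono)
qed

lemma support_upper:
  assumes "compact K" "x \<in> K"
  shows "a \<bullet> x \<le> support_fn K a"
  unfolding support_fn_def
proof (rule cSUP_upper[OF assms(2)])
  show "bdd_above ((\<bullet>) a ` K)"
    using assms(1) by (intro bounded_imp_bdd_above compact_imp_bounded compact_continuous_image)
      (auto intro!: continuous_intros)
qed

lemma support_least: "K \<noteq> {} \<Longrightarrow> (\<And>x. x \<in> K \<Longrightarrow> a \<bullet> x \<le> b) \<Longrightarrow> support_fn K a \<le> b"
  unfolding support_fn_def by (rule cSUP_least)

lemma support_pos:
  fixes K :: "(real ^ 'n) set"
  assumes "K \<in> bodies0" "a \<in> sphere 0 1"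
  shows "0 < support_fn K a"
proof -
  obtain e where e: "e > 0" "cball 0 e \<subseteq> K" using bodies0_ball assms(1) by blast
  then have "e *\<^sub>R a \<in> K" using assms(2) by auto
  then have "a \<bullet> (e *\<^sub>R a) \<le> support_fn K a" using support_upper bodies0D(1)[OF assms(1)] by blast
  moreover have "a \<bullet> a = 1" using assms(2) by (simp add: dot_square_norm)
  ultimately show ?thesis using e by simp
qed

text \<open>Separation of a point from a closed convex set. The support function is replaced by a witness in
\<open>K\<close> because the lemma is also used for the convex hull of a union, where a bound on \<open>a \<bullet> x\<close> comes from
one of the two bodies.\<close>

lemma mem_if_support:
  fixes K :: "(real ^ 'n) set"
  assumes K: "closed K" "convex K" "K \<noteq> {}"
    and "\<And>a. a \<in> sphere 0 1 \<Longrightarrow> \<exists>b\<ge>a \<bullet> x. \<exists>y\<in>K. b \<le> a \<bullet> y"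
  shows "x \<in> K"
proof (rule ccontr)
  assume "x \<notin> K"
  then obtain a b where ab: "a \<bullet> x < b" "\<And>y. y \<in> K \<Longrightarrow> b < a \<bullet> y"
    using separating_hyperplane_closed_point[OF K(2,1)] by metis
  have "a \<noteq> 0" using ab K(3) by fastforce
  define u where "u = - (1 / norm a) *\<^sub>R a"
  have "u \<in> sphere 0 1" using \<open>a \<noteq> 0\<close> by (simp add: u_def)
  then obtain c y where "y \<in> K" "u \<bullet> x \<le> c" "c \<le> u \<bullet> y" using assms(4) by blast
  then have "u \<bullet> x \<le> u \<bullet> y" "a \<bullet> x < a \<bullet> y" using ab by fastforce+
  then show False using \<open>a \<noteq> 0\<close> by (simp add: u_def divide_right_mono divide_le_cancel)
qed

lemma support_attained:
  fixes K :: "(real ^ 'n) set"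
  assumes "compact K" "K \<noteq> {}"
  shows "\<exists>y\<in>K. support_fn K a = a \<bullet> y"
proof -
  obtain y where y: "y \<in> K" "\<And>x. x \<in> K \<Longrightarrow> a \<bullet> x \<le> a \<bullet> y"
    using continuous_attains_sup[OF assms, of "(\<bullet>) a"] continuous_on_inner[of K "\<lambda>_. a" "\<lambda>x. x"]
    by auto
  then show ?thesis using support_least[OF assms(2), of a] support_upper[OF assms(1)]
    by (metis antisym)
qed

lemma body_mem_if_support:
  fixes K :: "(real ^ 'n) set"
  assumes "K \<in> bodies0" "\<And>a. a \<in> sphere 0 1 \<Longrightarrow> a \<bullet> x \<le> support_fn K a"
  shows "x \<in> K"
proof (rule mem_if_support)
  show "\<exists>b\<ge>a \<bullet> x. \<exists>y\<in>K. b \<le> a \<bullet> y" if "a \<in> sphere 0 1" for a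
    using assms(2)[OF that] support_attained[of K a] bodies0D[OF assms(1)] by (metis empty_iff order_refl)
qed (use bodies0D[OF assms(1)] in auto)

text \<open>The covering radius is an attained minimum, because it bounds the gauge of \<open>L\<close> on \<open>K\<close>.\<close>

lemma covering_radius_covers:
  fixes K L :: "(real ^ 'n) set"
  assumes K: "K \<in> bodies0" and L: "L \<in> bodies0"
  shows "K \<subseteq> (*\<^sub>R) (covering_radius K L) ` L"
proof
  fix x assume x: "x \<in> K"
  obtain c where c: "c > 0" "K \<subseteq> (*\<^sub>R) c ` L" using body_absorbs[OF L bodies0D(4)[OF K]] by blast
  have "gauge_fn L x \<le> covering_radius K L"
    using c x by (intro covering_radius_ge[of c]) (auto intro: gauge_le)
  then show "x \<in> (*\<^sub>R) (covering_radius K L) ` L"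
    using gauge_mem[OF L, of x] scaleR_image_mono[of L "gauge_fn L x" "covering_radius K L"]
      bodies0D[OF L] gauge_nonneg[OF L, of x] by blast
qed

lemma covering_radius_pos:
  fixes K L :: "(real ^ 'n) set"
  assumes K: "K \<in> bodies0" and L: "L \<in> bodies0"
  shows "0 < covering_radius K L"
proof -
  obtain e where e: "e > 0" "cball 0 e \<subseteq> K" using bodies0_ball K by blast
  obtain i :: 'n where True by blast
  define x :: "real ^ 'n" where "x = e *\<^sub>R axis i 1"
  have "x \<in> K" "x \<noteq> 0" using e by (auto simp: x_def axis_eq_0_iff norm_axis_1)
  then obtain y where y: "x = covering_radius K L *\<^sub>R y"
    using covering_radius_covers[OF K L] by blast
  obtain c where c: "c > 0" "K \<subseteq> (*\<^sub>R) c ` L" using body_absorbs[OF L bodies0D(4)[OF K]] by blast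
  have "0 \<le> covering_radius K L" using c by (intro covering_radius_ge[of c]) simp_all
  moreover have "covering_radius K L \<noteq> 0" using y \<open>x \<noteq> 0\<close> by simp_all
  ultimately show ?thesis by simp
qed

text \<open>For the least \<open>R\<close> with \<open>K \<subseteq> R L\<close> the two boundaries must meet: if \<open>K / R\<close> were inside the interior of
\<open>L\<close>, compactness would leave a margin and a smaller factor would do. A hyperplane supporting \<open>R L\<close>
at a common point also supports the smaller set \<open>K\<close>.\<close>

lemma touching_point:
  fixes K L :: "(real ^ 'n) set"
  assumes K: "K \<in> bodies0" and L: "L \<in> bodies0"
  defines "R \<equiv> covering_radius K L"
  shows "\<exists>x\<in>K. \<exists>a\<in>sphere 0 1. a \<bullet> x = R * support_fn L a \<and> a \<bullet> x = support_fn K a \<and> gauge_fn L x \<le> R"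
proof -
  have R: "0 < R" using covering_radius_pos[OF K L] by (simp add: R_def)
  have KL: "K \<subseteq> (*\<^sub>R) R ` L" using covering_radius_covers[OF K L] by (simp add: R_def)
  define K' where "K' = (*\<^sub>R) (1 / R) ` K"
  have K': "compact K'" unfolding K'_def by (intro compact_scaling bodies0D(1)[OF K])
  have sub: "K' \<subseteq> L" using KL R by (auto simp: K'_def)
  have "\<not> K' \<subseteq> interior L"
  proof
    assume "K' \<subseteq> interior L"
    then obtain d where d: "d > 0" "(\<Union>x\<in>K'. cball x d) \<subseteq> interior L"
      using compact_subset_open_imp_cball_epsilon_subset[OF K' open_interior] by blast
    obtain B where B: "B > 0" "\<And>x. x \<in> K' \<Longrightarrow> norm x \<le> B"
      by (rule bounded_normE[OF compact_imp_bounded[OF K']]) (rule that)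
    \<comment> \<open>Every point of \<open>K'\<close> can be stretched by \<open>s\<close>, as this moves it by at most \<open>d\<close>.\<close>
    define s where "s = 1 + d / B"
    have s: "s > 1" using d B by (simp add: s_def)
    have "s *\<^sub>R y \<in> L" if "y \<in> K'" for y
    proof -
      have "dist y (s *\<^sub>R y) = d / B * norm y"
        using d B by (simp add: dist_norm s_def algebra_simps)
      also have "\<dots> \<le> d / B * B" using B that d by (intro mult_left_mono) simp_all
      finally have "s *\<^sub>R y \<in> cball y d" using B by simp
      then show ?thesis using d(2) that interior_subset by blast
    qed
    then have "K \<subseteq> (*\<^sub>R) (R / s) ` L"
    proof -
      have "(s / R) *\<^sub>R x \<in> L" if "x \<in> K" for x
        using \<open>\<And>y. y \<in> K' \<Longrightarrow> s *\<^sub>R y \<in> L\<close>[of "(1 / R) *\<^sub>R x"] that by (auto simp: K'_def)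
      then show ?thesis using R s by (auto simp: mem_scaleR_image_iff)
    qed
    then have "R \<le> R / s" unfolding R_def[symmetric] using R s covering_radius_le[of "R / s" K L]
      by (simp add: R_def)
    then show False using R s by (simp add: field_simps)
  qed
  then obtain y where y: "y \<in> K'" "y \<notin> interior L" by blast
  obtain a b where ab: "a \<noteq> 0" "\<And>z. z \<in> interior L \<Longrightarrow> a \<bullet> z \<le> b" "b \<le> a \<bullet> y"
    using separating_hyperplane_sets[of "interior L" "{y}"] y(2) bodies0D(2)[OF L] L
    by (auto simp: bodies0_def)
  have "closure (interior L) = L"
    using L bodies0D[OF L] convex_closure_interior[of L] by (auto simp: bodies0_def)
  then have ab2: "a \<bullet> z \<le> b" if "z \<in> L" for z
    using that ab(2) closure_minimal[of "interior L" "{z. a \<bullet> z \<le> b}"] closed_halfspace_le by blast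
  define u where "u = (1 / norm a) *\<^sub>R a"
  have u: "u \<in> sphere 0 1" using ab(1) by (simp add: u_def)
  have uy: "u \<bullet> z \<le> u \<bullet> y" if "z \<in> L" for z
    using ab2[OF that] ab(3) ab(1) by (simp add: u_def divide_right_mono)
  have yL: "y \<in> L" using y sub by blast
  have h: "support_fn L u = u \<bullet> y"
    using uy yL support_upper[OF bodies0D(1)[OF L]] support_least[of L] by (metis antisym empty_iff)
  define x where "x = R *\<^sub>R y"
  have x: "x \<in> K" using y(1) R by (auto simp: x_def K'_def)
  have "u \<bullet> z \<le> u \<bullet> x" if z: "z \<in> K" for z
  proof -
    obtain w where "w \<in> L" "z = R *\<^sub>R w" using z KL by auto
    then show ?thesis using uy[of w] R by (simp add: x_def)
  qed
  then have "support_fn K u = u \<bullet> x"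
    using x support_upper[OF bodies0D(1)[OF K]] support_least[of K] by (metis antisym empty_iff)
  moreover have "gauge_fn L x \<le> R" using yL R by (intro gauge_le) (simp_all add: x_def)
  ultimately show ?thesis using x u h by (intro bexI[of _ x] bexI[of _ u]) (simp_all add: x_def)
qed

section \<open>Comparing the means of two bodies\<close>

lemma upper_mean_commute: "upper_mean p K L = upper_mean p L K"
  by (simp add: upper_mean_def pmean_commute)

lemma lower_mean_commute: "lower_mean p K L = lower_mean p L K"
  by (simp add: lower_mean_def pmean_commute)

lemma mean_of_commute: "mean_of s p K L = mean_of s p L K"
  by (cases s) (simp_all add: upper_mean_commute lower_mean_commute)

lemma covering_distance_commute: "covering_distance K L = covering_distance L K"
  by (simp add: covering_distance_def max.commute)

lemma convex_lower_mean: "convex (lower_mean p K L)"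
  by (simp add: lower_mean_def)

lemma lower_mean_generator:
  fixes K L :: "(real ^ 'n) set"
  assumes "K \<in> bodies0" "L \<in> bodies0" "v \<noteq> 0"
  shows "pmean p (inverse (gauge_fn K v)) (inverse (gauge_fn L v)) *\<^sub>R v
      = (1 / pmean (- p) (gauge_fn K v) (gauge_fn L v)) *\<^sub>R v"
  using assms by (subst pmean_inverse) (simp_all add: gauge_pos divide_inverse)

text \<open>The generators in two opposite directions are positive multiples of \<open>v\<close> and \<open>-v\<close>, and the segment
between them passes through the origin.\<close>

lemma zero_in_lower_mean:
  fixes K L :: "(real ^ 'n) set"
  assumes K: "K \<in> bodies0" and L: "L \<in> bodies0"
  shows "0 \<in> lower_mean p K L"
proof -
  obtain v :: "real ^ 'n" where v: "norm v = 1" using vector_choose_size[of 1] by auto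
  define r where "r v = pmean p (inverse (gauge_fn K v)) (inverse (gauge_fn L v))" for v
  have pos: "0 < r v" if "v \<noteq> 0" for v
    unfolding r_def using that K L by (intro pmean_pos) (simp_all add: gauge_pos)
  have mem: "r v *\<^sub>R v \<in> lower_mean p K L" if "norm v = 1" for v
    unfolding lower_mean_def r_def using that by (intro hull_inc) simp_all
  define s t where "s = r v" and "t = r (- v)"
  have st: "0 < s" "0 < t" using pos[of v] pos[of "- v"] v by (cases "v = 0"; simp add: s_def t_def)+
  have "(t / (s + t)) *\<^sub>R (s *\<^sub>R v) + (s / (s + t)) *\<^sub>R (t *\<^sub>R (- v)) \<in> lower_mean p K L"
    using st mem[of v] mem[of "- v"] v
    by (intro convexD[OF convex_lower_mean]) (simp_all add: s_def t_def add_divide_distrib[symmetric])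
  then show ?thesis by (simp add: mult.commute)
qed

text \<open>The generator of the lower mean in the direction of \<open>x\<close> is \<open>x / m\<^sub>-\<^sub>p(\<parallel>x\<parallel>\<^sub>K, \<parallel>x\<parallel>\<^sub>L)\<close>; the hull contains
it, the origin and the points in between.\<close>

lemma lower_mean_intro:
  fixes K L :: "(real ^ 'n) set"
  assumes K: "K \<in> bodies0" and L: "L \<in> bodies0" and c: "0 < c"
    and le: "x \<noteq> 0 \<Longrightarrow> pmean (- p) (gauge_fn K x) (gauge_fn L x) \<le> c"
  shows "x \<in> (*\<^sub>R) c ` lower_mean p K L"
proof (cases "x = 0")
  case True
  then show ?thesis using zero_in_lower_mean[OF K L] by (intro rev_image_eqI[of 0]) simp_all
next
  case False
  define M where "M = pmean (- p) (gauge_fn K x) (gauge_fn L x)"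
  define v where "v = (1 / norm x) *\<^sub>R x"
  have n: "0 < norm x" using False by simp
  have M: "0 < M" unfolding M_def using False K L by (simp add: pmean_pos gauge_pos)
  have "pmean (- p) (gauge_fn K v) (gauge_fn L v) = (1 / norm x) * M"
    unfolding M_def v_def using n False K L
    by (simp only: gauge_scale zero_less_divide_1_iff) (intro pmean_scale, simp_all add: gauge_pos)
  then have "(1 / ((1 / norm x) * M)) *\<^sub>R v \<in> lower_mean p K L"
    unfolding lower_mean_def using n lower_mean_generator[OF K L, of v p]
    by (intro hull_inc image_eqI[of _ _ v]) (simp_all add: v_def)
  then have "(M / c) *\<^sub>R ((1 / ((1 / norm x) * M)) *\<^sub>R v) + (1 - M / c) *\<^sub>R 0 \<in> lower_mean p K L"
    using M c le[OF False] zero_in_lower_mean[OF K L, of p]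
    by (intro convexD[OF convex_lower_mean]) (simp_all add: M_def)
  moreover have "(M / c) *\<^sub>R ((1 / ((1 / norm x) * M)) *\<^sub>R v) = (1 / c) *\<^sub>R x"
    using n M by (simp add: v_def)
  ultimately show ?thesis using c by (simp add: mem_scaleR_image_iff)
qed

text \<open>The generators are precisely the points with \<open>m\<^sub>-\<^sub>p(\<parallel>z\<parallel>\<^sub>K, \<parallel>z\<parallel>\<^sub>L) = 1\<close>. This is how inclusions and
linear inequalities for lower means are checked below.\<close>

lemma lower_mean_subset:
  fixes K L :: "(real ^ 'n) set"
  assumes K: "K \<in> bodies0" and L: "L \<in> bodies0" and S: "convex S"
    and gen: "\<And>z. z \<noteq> 0 \<Longrightarrow> pmean (- p) (gauge_fn K z) (gauge_fn L z) = 1 \<Longrightarrow> z \<in> S"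
  shows "lower_mean p K L \<subseteq> S"
  unfolding lower_mean_def
proof (rule hull_minimal, clarify)
  fix v :: "real ^ 'n" assume "v \<in> sphere 0 1"
  then have v: "v \<noteq> 0" by auto
  define M where "M = pmean (- p) (gauge_fn K v) (gauge_fn L v)"
  have M: "0 < M" unfolding M_def using v K L by (simp add: pmean_pos gauge_pos)
  have "pmean (- p) (gauge_fn K ((1 / M) *\<^sub>R v)) (gauge_fn L ((1 / M) *\<^sub>R v)) = (1 / M) * M"
    using M v K L unfolding gauge_scale[OF K, of "1 / M"]
    by (simp only: gauge_scale zero_less_divide_1_iff)
       (subst M_def(1), intro pmean_scale, simp_all add: gauge_pos)
  then have "(1 / M) *\<^sub>R v \<in> S" using M v by (intro gen) simp_all
  then show "pmean p (inverse (gauge_fn K v)) (inverse (gauge_fn L v)) *\<^sub>R v \<in> S"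
    unfolding lower_mean_generator[OF K L v] M_def .
qed (rule S)

lemma upper_mean_inner_le:
  "x \<in> upper_mean p K L \<Longrightarrow> a \<in> sphere 0 1 \<Longrightarrow> a \<bullet> x \<le> pmean p (support_fn K a) (support_fn L a)"
  by (simp add: upper_mean_def)

lemma convex_upper_mean: "convex (upper_mean p K L)"
proof -
  have "upper_mean p K L
      = (\<Inter>a\<in>sphere 0 1. {x. a \<bullet> x \<le> pmean p (support_fn K a) (support_fn L a)})"
    by (auto simp: upper_mean_def)
  then show ?thesis by (simp add: convex_INT convex_halfspace_le)
qed

lemma pmean_support_pos:
  fixes K L :: "(real ^ 'n) set"
  assumes "K \<in> bodies0" "L \<in> bodies0" "a \<in> sphere 0 1"
  shows "0 < pmean p (support_fn K a) (support_fn L a)"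
  using assms by (intro pmean_pos support_pos)

lemma inner_le_support_gauge:
  fixes K :: "(real ^ 'n) set"
  assumes "K \<in> bodies0"
  shows "a \<bullet> x \<le> support_fn K a * gauge_fn K x"
  using assms by (intro inner_le_gauge support_upper bodies0D)

text \<open>If \<open>a \<bullet> z > 0\<close> then \<open>(a \<bullet> z) / \<parallel>z\<parallel>\<^sub>K \<le> h\<^sub>K(a)\<close>, and likewise for \<open>L\<close>. Taking \<open>p\<close>-means and using that the
mean of the reciprocal gauges of a generator is \<open>1\<close> gives the inequality defining the upper mean.\<close>

lemma lower_subset_upper:
  fixes K L :: "(real ^ 'n) set"
  assumes K: "K \<in> bodies0" and L: "L \<in> bodies0"
  shows "lower_mean p K L \<subseteq> upper_mean p K L"
proof (rule lower_mean_subset[OF K L convex_upper_mean])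
  fix z :: "real ^ 'n"
  assume z: "z \<noteq> 0" and 1: "pmean (- p) (gauge_fn K z) (gauge_fn L z) = 1"
  have "a \<bullet> z \<le> pmean p (support_fn K a) (support_fn L a)" if a: "a \<in> sphere 0 1" for a
  proof (cases "0 < a \<bullet> z")
    case True
    have le: "(a \<bullet> z) * inverse (gauge_fn C z) \<le> support_fn C a" if "C \<in> bodies0" for C
      using inner_le_support_gauge[OF that, of a z] gauge_pos[OF that z] by (simp add: field_simps)
    have "a \<bullet> z = (a \<bullet> z) * pmean p (inverse (gauge_fn K z)) (inverse (gauge_fn L z))"
      using 1 z K L by (simp add: pmean_inverse gauge_pos)
    also have "\<dots> = pmean p ((a \<bullet> z) * inverse (gauge_fn K z)) ((a \<bullet> z) * inverse (gauge_fn L z))"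
      using True z K L by (intro pmean_scale[symmetric]) (simp_all add: gauge_pos)
    also have "\<dots> \<le> pmean p (support_fn K a) (support_fn L a)"
      using True z K L by (intro pmean_mono le mult_pos_pos) (simp_all add: gauge_pos)
    finally show ?thesis .
  next
    case False
    then show ?thesis using pmean_support_pos[OF K L a, of p] by linarith
  qed
  then show "z \<in> upper_mean p K L" by (simp add: upper_mean_def)
qed

lemma support_le_of_covering:
  fixes K L :: "(real ^ 'n) set"
  assumes K: "K \<in> bodies0" and L: "L \<in> bodies0" and R: "K \<subseteq> (*\<^sub>R) R ` L" "0 \<le> R"
  shows "support_fn K a \<le> R * support_fn L a"
proof (rule support_least)
  fix x assume "x \<in> K"
  then obtain y where "y \<in> L" "x = R *\<^sub>R y" using R by auto
  then show "a \<bullet> x \<le> R * support_fn L a"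
    using support_upper[OF bodies0D(1)[OF L], of y a] R(2) by (simp add: mult_left_mono)
qed (use bodies0D[OF K] in auto)

lemma gauge_le_of_covering:
  fixes K L :: "(real ^ 'n) set"
  assumes K: "K \<in> bodies0" and R: "K \<subseteq> (*\<^sub>R) R ` L" "0 \<le> R"
  shows "gauge_fn L x \<le> R * gauge_fn K x"
proof -
  obtain y where y: "y \<in> K" "x = gauge_fn K x *\<^sub>R y" using gauge_mem[OF K, of x] by auto
  from y(1) obtain z where z: "z \<in> L" "y = R *\<^sub>R z" using R(1) by auto
  have "gauge_fn K x *\<^sub>R y = (R * gauge_fn K x) *\<^sub>R z" by (simp add: z(2) mult.commute)
  with y(2) have "x = (R * gauge_fn K x) *\<^sub>R z" by (rule trans)
  with z(1) have "x \<in> (*\<^sub>R) (R * gauge_fn K x) ` L" by (intro image_eqI)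
  then show ?thesis using R(2) gauge_nonneg[OF K, of x] by (intro gauge_le mult_nonneg_nonneg)
qed

lemma covering_distance_covers:
  fixes K L :: "(real ^ 'n) set"
  assumes K: "K \<in> bodies0" and L: "L \<in> bodies0"
  shows "K \<subseteq> (*\<^sub>R) (covering_distance K L) ` L"
  using covering_radius_covers[OF K L] covering_radius_pos[OF K L]
    scaleR_image_mono[OF bodies0D(2,5)[OF L], of "covering_radius K L" "covering_distance K L"]
  by (simp_all add: covering_distance_def)

text \<open>Applying the two gauge inequalities one after the other gives \<open>\<parallel>v\<parallel>\<^sub>L \<le> R\<^sup>2 \<parallel>v\<parallel>\<^sub>L\<close>.\<close>

lemma covering_distance_ge_one:
  fixes K L :: "(real ^ 'n) set"
  assumes K: "K \<in> bodies0" and L: "L \<in> bodies0"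
  shows "1 \<le> covering_distance K L"
proof -
  define R where "R = covering_distance K L"
  have R: "0 < R" using covering_radius_pos[OF K L] by (simp add: covering_distance_def R_def)
  obtain v :: "real ^ 'n" where "norm v = 1" using vector_choose_size[of 1] by auto
  then have v: "v \<noteq> 0" by auto
  have "gauge_fn L v \<le> R * gauge_fn K v" "gauge_fn K v \<le> R * gauge_fn L v"
    using gauge_le_of_covering[OF K covering_distance_covers[OF K L]]
      gauge_le_of_covering[OF L covering_distance_covers[OF L K]] R
    by (simp_all add: R_def covering_distance_commute)
  then have "gauge_fn L v \<le> R * (R * gauge_fn L v)"
    using R by (meson mult_left_mono order_trans less_imp_le)
  then have "1 \<le> R * R" using gauge_pos[OF L v] by simp
  moreover have "R * R < 1" if "R < 1" using mult_strict_mono[of R 1 R 1] that R by simp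
  ultimately show ?thesis unfolding R_def[symmetric] by linarith
qed


lemma dist_ge_1:
  fixes K L :: "(real ^ 'n) set"
  assumes K: "K \<in> bodies0" and L: "L \<in> bodies0" and dist: "covering_distance K L = R"
  shows "1 \<le> R"
  using covering_distance_ge_one[OF K L] dist by simp_all

lemma dist_pos:
  fixes K L :: "(real ^ 'n) set"
  assumes K: "K \<in> bodies0" and L: "L \<in> bodies0" and dist: "covering_distance K L = R"
  shows "0 < R"
  using dist_ge_1[OF K L dist] by simp

lemma dist_covers:
  fixes K L :: "(real ^ 'n) set"
  assumes K: "K \<in> bodies0" and L: "L \<in> bodies0" and dist: "covering_distance K L = R"
  shows "K \<subseteq> (*\<^sub>R) R ` L" "L \<subseteq> (*\<^sub>R) R ` K"
  using covering_distance_covers[OF K L] covering_distance_covers[OF L K] dist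
  by (simp_all add: covering_distance_commute)

lemma support_ratio:
  fixes K L :: "(real ^ 'n) set"
  assumes K: "K \<in> bodies0" and L: "L \<in> bodies0" and dist: "covering_distance K L = R"
  shows "support_fn K a \<le> R * support_fn L a" "support_fn L a \<le> R * support_fn K a"
  using support_le_of_covering[OF K L dist_covers(1)[OF K L dist]] support_le_of_covering[OF L K dist_covers(2)[OF K L dist]] dist_pos[OF K L dist] by simp_all

lemma gauge_ratio:
  fixes K L :: "(real ^ 'n) set"
  assumes K: "K \<in> bodies0" and L: "L \<in> bodies0" and dist: "covering_distance K L = R"
  shows "gauge_fn K x \<le> R * gauge_fn L x" "gauge_fn L x \<le> R * gauge_fn K x"
  using gauge_le_of_covering[OF K dist_covers(1)[OF K L dist]] gauge_le_of_covering[OF L dist_covers(2)[OF K L dist]] dist_pos[OF K L dist] by simp_all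

lemma pmean_dist_pos:
  fixes K L :: "(real ^ 'n) set"
  assumes K: "K \<in> bodies0" and L: "L \<in> bodies0" and dist: "covering_distance K L = R"
  shows "0 < pmean p R 1"
  using dist_pos[OF K L dist] by (simp add: pmean_pos)

lemma upper_subset_upper:
  fixes K L :: "(real ^ 'n) set"
  assumes K: "K \<in> bodies0" and L: "L \<in> bodies0" and dist: "covering_distance K L = R"
    and "q \<le> p"
  shows "upper_mean p K L \<subseteq> (*\<^sub>R) (pmean p R 1 / pmean q R 1) ` upper_mean q K L"
proof
  fix x assume x: "x \<in> upper_mean p K L"
  define c where "c = pmean p R 1 / pmean q R 1"
  have c: "0 < c" by (simp add: c_def pmean_dist_pos[OF K L dist])
  have "a \<bullet> x \<le> c * pmean q (support_fn K a) (support_fn L a)" if a: "a \<in> sphere 0 1" for a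
    using upper_mean_inner_le[OF x a] support_ratio[OF K L dist, of a] support_pos[OF K a] support_pos[OF L a]
      pmean_le_ratio[OF assms(4), of "support_fn K a" "support_fn L a" R]
    unfolding c_def by linarith
  then show "x \<in> (*\<^sub>R) c ` upper_mean q K L"
    using c by (simp add: mem_scaleR_image_iff upper_mean_def pos_divide_le_eq mult.commute)
qed

lemma lower_subset_lower:
  fixes K L :: "(real ^ 'n) set"
  assumes K: "K \<in> bodies0" and L: "L \<in> bodies0" and dist: "covering_distance K L = R"
    and "q \<le> p"
  shows "lower_mean p K L \<subseteq> (*\<^sub>R) (pmean p R 1 / pmean q R 1) ` lower_mean q K L"
proof (rule lower_mean_subset[OF K L])
  show "convex ((*\<^sub>R) (pmean p R 1 / pmean q R 1) ` lower_mean q K L)"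
    by (intro convex_scaling convex_lower_mean)
next
  fix z :: "real ^ 'n"
  assume z: "z \<noteq> 0" and 1: "pmean (- p) (gauge_fn K z) (gauge_fn L z) = 1"
  have "pmean (- q) (gauge_fn K z) (gauge_fn L z)
      \<le> pmean (- q) R 1 / pmean (- p) R 1 * pmean (- p) (gauge_fn K z) (gauge_fn L z)"
    using assms K L z by (intro pmean_le_ratio gauge_ratio[OF K L dist] gauge_pos) simp_all
  also have "\<dots> = pmean p R 1 / pmean q R 1"
    using dist_pos[OF K L dist] 1 pmean_dist_pos[OF K L dist, of p] by (simp add: pmean_uminus_R)
  finally show "z \<in> (*\<^sub>R) (pmean p R 1 / pmean q R 1) ` lower_mean q K L"
    using K L pmean_dist_pos[OF K L dist] by (intro lower_mean_intro) simp_all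
qed

lemma mean_subset_mean:
  fixes K L :: "(real ^ 'n) set"
  assumes K: "K \<in> bodies0" and L: "L \<in> bodies0" and dist: "covering_distance K L = R"
    and "(s, t) \<noteq> (Upper, Lower)" "q \<le> p"
  shows "mean_of s p K L \<subseteq> (*\<^sub>R) (pmean p R 1 / pmean q R 1) ` mean_of t q K L"
  using assms lower_subset_lower[OF K L dist assms(5)] upper_subset_upper[OF K L dist assms(5)]
    lower_subset_upper[OF K L, of p]
  by (cases s; cases t) simp_all

lemma mean_mono:
  fixes K L :: "(real ^ 'n) set"
  assumes K: "K \<in> bodies0" and L: "L \<in> bodies0"
    and "(s, t) \<noteq> (Upper, Lower)" "p \<le> q"
  shows "mean_of s p K L \<subseteq> mean_of t q K L"
proof -
  have U: "upper_mean p K L \<subseteq> upper_mean q K L"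
    using pmean_mono_exponent[OF assms(4)] support_pos[OF K] support_pos[OF L]
    unfolding upper_mean_def by (blast intro: order_trans)
  have "lower_mean p K L \<subseteq> (*\<^sub>R) 1 ` lower_mean q K L"
  proof (rule lower_mean_subset[OF K L])
    show "convex ((*\<^sub>R) 1 ` lower_mean q K L)"
      by (intro convex_scaling convex_lower_mean)
  next
    fix z :: "real ^ 'n"
    assume z: "z \<noteq> 0" and 1: "pmean (- p) (gauge_fn K z) (gauge_fn L z) = 1"
    then have "pmean (- q) (gauge_fn K z) (gauge_fn L z) \<le> 1"
      using pmean_mono_exponent[of "- q" "- p" "gauge_fn K z" "gauge_fn L z"] assms K L
      by (simp add: gauge_pos)
    then show "z \<in> (*\<^sub>R) 1 ` lower_mean q K L"
      using K L by (intro lower_mean_intro) simp_all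
  qed
  then have "lower_mean p K L \<subseteq> lower_mean q K L" by simp
  then show ?thesis using assms(3) U lower_subset_upper[OF K L, of p] by (cases s; cases t) simp_all
qed

text \<open>At a touching point \<open>x\<close> of \<open>K\<close> and \<open>R L\<close> with normal \<open>a\<close> put \<open>h = h\<^sub>L(a)\<close>, so that \<open>h\<^sub>K(a) = R h\<close>. The
multiple of \<open>x\<close> with value \<open>m\<^sub>p(R, 1) h\<close> under \<open>a\<close> lies already in the lower \<open>p\<close>-mean, while \<open>a\<close> is at most
\<open>m\<^sub>q(R, 1) h\<close> even on the upper \<open>q\<close>-mean. The kinds of the two means can therefore be arbitrary.\<close>

lemma mean_radius_ge_at_touching_point:
  fixes K L :: "(real ^ 'n) set"
  assumes K: "K \<in> bodies0" and L: "L \<in> bodies0"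
    and R: "R = covering_radius K L" "1 \<le> R"
    and l: "0 \<le> l" "mean_of s p K L \<subseteq> (*\<^sub>R) l ` mean_of t q K L"
  shows "pmean p R 1 / pmean q R 1 \<le> l"
proof -
  obtain x a where x: "x \<in> K" and a: "a \<in> sphere 0 1" and ax: "a \<bullet> x = R * support_fn L a"
    "a \<bullet> x = support_fn K a" and g: "gauge_fn L x \<le> R"
    using touching_point[OF K L] R(1) by auto
  define h where "h = support_fn L a"
  have h: "0 < h" using support_pos[OF L a] by (simp add: h_def)
  define m where "m = pmean p R 1"
  have m: "0 < m" "0 < pmean q R 1" using R by (simp_all add: m_def pmean_pos)
  have "x \<in> (*\<^sub>R) (R / m) ` lower_mean p K L"
  proof (rule lower_mean_intro[OF K L])
    show "0 < R / m" using R m by simp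
    assume "x \<noteq> 0"
    then have "pmean (- p) (gauge_fn K x) (gauge_fn L x) \<le> pmean (- p) 1 R"
      using K L g gauge_le_one[OF x] by (intro pmean_mono) (simp_all add: gauge_pos)
    also have "\<dots> = R / m" using R by (subst pmean_commute) (simp add: m_def pmean_uminus_R)
    finally show "pmean (- p) (gauge_fn K x) (gauge_fn L x) \<le> R / m" .
  qed
  then have "(m / R) *\<^sub>R x \<in> lower_mean p K L" using R m by (simp add: mem_scaleR_image_iff)
  then have "(m / R) *\<^sub>R x \<in> mean_of s p K L"
    using lower_subset_upper[OF K L, of p] by (cases s) auto
  then obtain y where y: "y \<in> mean_of t q K L" "(m / R) *\<^sub>R x = l *\<^sub>R y" using l(2) by blast
  then have "y \<in> upper_mean q K L"
    using lower_subset_upper[OF K L, of q] by (cases t) auto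
  then have "a \<bullet> y \<le> pmean q (R * h) (1 * h)"
    using upper_mean_inner_le[of y q K L a] a ax by (simp add: h_def)
  also have "\<dots> = h * pmean q R 1"
    using pmean_scale[of h R 1 q] h R by (simp add: mult.commute)
  finally have ay: "a \<bullet> y \<le> h * pmean q R 1" .
  have "m * h = a \<bullet> ((m / R) *\<^sub>R x)" using ax R by (simp add: h_def)
  also have "\<dots> = l * (a \<bullet> y)" by (simp add: y(2))
  also have "\<dots> \<le> l * (h * pmean q R 1)" using ay l(1) by (intro mult_left_mono)
  finally have "m \<le> l * pmean q R 1" using h by (simp add: mult.left_commute mult.commute[of m])
  then show ?thesis using m by (simp add: m_def pos_divide_le_eq)
qed


lemma mean_radius_ge:
  fixes K L :: "(real ^ 'n) set"
  assumes K: "K \<in> bodies0" and L: "L \<in> bodies0" and dist: "covering_distance K L = R"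
    and "0 \<le> l" "mean_of s p K L \<subseteq> (*\<^sub>R) l ` mean_of t q K L"
  shows "pmean p R 1 / pmean q R 1 \<le> l"
proof (cases "covering_radius L K \<le> covering_radius K L")
  case True
  then have "R = covering_radius K L" using dist by (simp add: covering_distance_def)
  then show ?thesis using mean_radius_ge_at_touching_point[OF K L _ dist_ge_1[OF K L dist] assms(4) assms(5)] by simp
next
  case False
  then have "R = covering_radius L K" using dist by (simp add: covering_distance_def)
  then show ?thesis using mean_radius_ge_at_touching_point[OF L K _ dist_ge_1[OF K L dist] assms(4)] assms(5)
    by (simp add: mean_of_commute)
qed

lemma mean_radius_eq:
  fixes K L :: "(real ^ 'n) set"
  assumes K: "K \<in> bodies0" and L: "L \<in> bodies0" and dist: "covering_distance K L = R"
    and "(s, t) \<noteq> (Upper, Lower)" "q \<le> p"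
  shows "covering_radius (mean_of s p K L) (mean_of t q K L) = pmean p R 1 / pmean q R 1"
  using pmean_dist_pos[OF K L dist]
  by (intro covering_radius_eq mean_subset_mean[OF K L dist] mean_radius_ge[OF K L dist] assms)
    (auto intro!: divide_nonneg_nonneg less_imp_le)

lemma mean_radius_le_one:
  fixes K L :: "(real ^ 'n) set"
  assumes K: "K \<in> bodies0" and L: "L \<in> bodies0"
    and "(s, t) \<noteq> (Upper, Lower)" "p \<le> q"
  shows "covering_radius (mean_of s p K L) (mean_of t q K L) \<le> 1"
  using mean_mono[OF K L assms(3) assms(4)] by (intro covering_radius_le) simp_all

lemma upper_subset_body:
  fixes K L :: "(real ^ 'n) set"
  assumes K: "K \<in> bodies0" and L: "L \<in> bodies0" and dist: "covering_distance K L = R"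
  shows "upper_mean p K L \<subseteq> (*\<^sub>R) (pmean p R 1) ` K" "upper_mean p K L \<subseteq> (*\<^sub>R) (pmean p R 1) ` L"
proof -
  have *: "upper_mean p A B \<subseteq> (*\<^sub>R) (pmean p R 1) ` A"
    if A: "A \<in> bodies0" and B: "B \<in> bodies0" and AB: "\<And>a. support_fn B a \<le> R * support_fn A a"
    for A B
  proof
    fix x assume x: "x \<in> upper_mean p A B"
    have "a \<bullet> ((1 / pmean p R 1) *\<^sub>R x) \<le> support_fn A a" if a: "a \<in> sphere 0 1" for a
    proof -
      have "a \<bullet> x \<le> pmean p (support_fn A a) (support_fn B a)" by (rule upper_mean_inner_le[OF x a])
      also have "\<dots> \<le> pmean p (support_fn A a * 1) (support_fn A a * R)"
        using support_pos[OF A a] support_pos[OF B a] AB[of a]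
        by (intro pmean_mono) (simp_all add: mult.commute)
      also have "\<dots> = support_fn A a * pmean p R 1"
        using support_pos[OF A a] dist_pos[OF K L dist] by (subst pmean_scale) (simp_all add: pmean_commute)
      finally show ?thesis using pmean_dist_pos[OF K L dist, of p] by (simp add: pos_divide_le_eq)
    qed
    then have "(1 / pmean p R 1) *\<^sub>R x \<in> A" by (rule body_mem_if_support[OF A])
    then show "x \<in> (*\<^sub>R) (pmean p R 1) ` A" using pmean_dist_pos[OF K L dist] by (simp add: mem_scaleR_image_iff)
  qed
  show "upper_mean p K L \<subseteq> (*\<^sub>R) (pmean p R 1) ` K" by (rule *[OF K L support_ratio(2)[OF K L dist]])
  show "upper_mean p K L \<subseteq> (*\<^sub>R) (pmean p R 1) ` L"
    using *[OF L K support_ratio(1)[OF K L dist]] by (simp add: upper_mean_commute)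
qed

lemma upper_subset_lower_via_bodies:
  fixes K L :: "(real ^ 'n) set"
  assumes K: "K \<in> bodies0" and L: "L \<in> bodies0" and dist: "covering_distance K L = R"
  shows "upper_mean p K L \<subseteq> (*\<^sub>R) (pmean p R 1) ` lower_mean q K L"
proof
  fix x assume x: "x \<in> upper_mean p K L"
  let ?m = "pmean p R 1"
  have g: "gauge_fn K x \<le> ?m" "gauge_fn L x \<le> ?m"
    using upper_subset_body[OF K L dist, of p] x pmean_dist_pos[OF K L dist, of p] by (auto intro!: gauge_le)
  show "x \<in> (*\<^sub>R) ?m ` lower_mean q K L"
  proof (rule lower_mean_intro[OF K L pmean_dist_pos[OF K L dist]])
    assume "x \<noteq> 0"
    then show "pmean (- q) (gauge_fn K x) (gauge_fn L x) \<le> ?m"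
      using pmean_bounds(2)[of "gauge_fn K x" "gauge_fn L x" "- q"] g K L by (simp add: gauge_pos)
  qed
qed

lemma body_subset_lower:
  fixes K L :: "(real ^ 'n) set"
  assumes K: "K \<in> bodies0" and L: "L \<in> bodies0" and dist: "covering_distance K L = R"
  shows "K \<subseteq> (*\<^sub>R) (pmean (- q) R 1) ` lower_mean q K L" "L \<subseteq> (*\<^sub>R) (pmean (- q) R 1) ` lower_mean q K L"
proof -
  have "x \<in> (*\<^sub>R) (pmean (- q) R 1) ` lower_mean q K L" if "x \<in> K \<or> x \<in> L" for x
  proof (rule lower_mean_intro[OF K L pmean_dist_pos[OF K L dist]])
    assume "x \<noteq> 0"
    then have pos: "0 < gauge_fn K x" "0 < gauge_fn L x" using K L by (auto intro: gauge_pos)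
    from that show "pmean (- q) (gauge_fn K x) (gauge_fn L x) \<le> pmean (- q) R 1"
    proof
      assume "x \<in> K"
      then have "gauge_fn K x \<le> 1" "gauge_fn L x \<le> R" using dist_covers[OF K L dist] dist_pos[OF K L dist]
        by (auto intro!: gauge_le_one gauge_le)
      then show ?thesis using pmean_mono[OF pos, of 1 R] by (simp add: pmean_commute)
    next
      assume "x \<in> L"
      then have "gauge_fn L x \<le> 1" "gauge_fn K x \<le> R" using dist_covers[OF K L dist] dist_pos[OF K L dist]
        by (auto intro!: gauge_le_one gauge_le)
      then show ?thesis using pmean_mono[OF pos, of R 1] by simp
    qed
  qed
  then show "K \<subseteq> (*\<^sub>R) (pmean (- q) R 1) ` lower_mean q K L"
    "L \<subseteq> (*\<^sub>R) (pmean (- q) R 1) ` lower_mean q K L" by auto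
qed

lemma upper_subset_hull:
  fixes K L :: "(real ^ 'n) set"
  assumes K: "K \<in> bodies0" and L: "L \<in> bodies0"
  shows "upper_mean p K L \<subseteq> convex hull (K \<union> L)"
proof
  fix x assume x: "x \<in> upper_mean p K L"
  show "x \<in> convex hull (K \<union> L)"
  proof (rule mem_if_support)
    show "closed (convex hull (K \<union> L))"
      using bodies0D(1)[OF K] bodies0D(1)[OF L]
      by (intro compact_imp_closed compact_convex_hull compact_Un)
    show "convex hull (K \<union> L) \<noteq> {}" using bodies0D(5)[OF K] by auto
    fix a :: "real ^ 'n" assume a: "a \<in> sphere 0 1"
    have "a \<bullet> x \<le> max (support_fn K a) (support_fn L a)"
      using upper_mean_inner_le[OF x a] pmean_bounds(2)[OF support_pos[OF K a] support_pos[OF L a], of p]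
      by linarith
    moreover obtain y where "y \<in> K" "support_fn K a = a \<bullet> y"
      using support_attained bodies0D[OF K] by (metis empty_iff)
    moreover obtain z where "z \<in> L" "support_fn L a = a \<bullet> z"
      using support_attained bodies0D[OF L] by (metis empty_iff)
    moreover have "K \<union> L \<subseteq> convex hull (K \<union> L)" by (rule hull_subset)
    ultimately show "\<exists>b\<ge>a \<bullet> x. \<exists>y\<in>convex hull (K \<union> L). b \<le> a \<bullet> y"
      by (intro exI[of _ "max (support_fn K a) (support_fn L a)"])
         (auto simp: max_def split: if_splits)
  qed (rule convex_convex_hull)
qed

lemma upper_subset_lower_via_hull:
  fixes K L :: "(real ^ 'n) set"
  assumes K: "K \<in> bodies0" and L: "L \<in> bodies0" and dist: "covering_distance K L = R"
  shows "upper_mean p K L \<subseteq> (*\<^sub>R) (pmean (- q) R 1) ` lower_mean q K L"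
proof -
  have "convex hull (K \<union> L) \<subseteq> (*\<^sub>R) (pmean (- q) R 1) ` lower_mean q K L"
    using body_subset_lower[OF K L dist] by (intro hull_minimal convex_scaling convex_lower_mean) simp_all
  then show ?thesis using upper_subset_hull[OF K L] by blast
qed

lemma upper_lower_radius_le:
  fixes K L :: "(real ^ 'n) set"
  assumes K: "K \<in> bodies0" and L: "L \<in> bodies0" and dist: "covering_distance K L = R"
  shows "covering_radius (upper_mean p K L) (lower_mean q K L) \<le> min (pmean p R 1) (pmean (- q) R 1)"
  using covering_radius_le[OF _ upper_subset_lower_via_bodies[OF K L dist]] covering_radius_le[OF _ upper_subset_lower_via_hull[OF K L dist]]
    pmean_dist_pos[OF K L dist] less_imp_le by (metis min.boundedI)

lemma upper_lower_radius_ge: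
  fixes K L :: "(real ^ 'n) set"
  assumes K: "K \<in> bodies0" and L: "L \<in> bodies0"
    and "\<And>l. 0 \<le> l \<Longrightarrow> upper_mean p K L \<subseteq> (*\<^sub>R) l ` lower_mean q K L \<Longrightarrow> b \<le> l"
  shows "b \<le> covering_radius (upper_mean p K L) (lower_mean q K L)"
  using pmean_dist_pos[OF K L refl, of p]
  by (intro covering_radius_ge[OF _ upper_subset_lower_via_bodies[OF K L refl]] assms(3)) simp_all

section \<open>An upper mean against a lower mean: the planar norm bound\<close>

definition pnorm :: "real \<Rightarrow> real \<Rightarrow> real \<Rightarrow> real" where
  "pnorm r x y = (\<bar>x\<bar> powr r + \<bar>y\<bar> powr r) powr (1 / r)"

lemma pnorm_commute: "pnorm r x y = pnorm r y x"
  by (simp add: pnorm_def add.commute)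

lemma pnorm_abs: "pnorm r \<bar>x\<bar> \<bar>y\<bar> = pnorm r x y"
  by (simp add: pnorm_def)

lemma pnorm_nonneg: "0 \<le> pnorm r x y"
  by (simp add: pnorm_def)

lemma pnorm_axis: "0 < r \<Longrightarrow> pnorm r x 0 = \<bar>x\<bar>" "0 < r \<Longrightarrow> pnorm r 0 x = \<bar>x\<bar>"
  by (simp_all add: pnorm_def powr_powr)

lemma pnorm_scale:
  assumes "0 < r" "0 \<le> c"
  shows "pnorm r (c * x) (c * y) = c * pnorm r x y"
proof -
  have "\<bar>c * x\<bar> powr r + \<bar>c * y\<bar> powr r = c powr r * (\<bar>x\<bar> powr r + \<bar>y\<bar> powr r)"
    using assms by (simp add: abs_mult powr_mult distrib_left)
  then show ?thesis using assms by (simp add: pnorm_def powr_mult powr_powr)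
qed

lemma pnorm_mono:
  assumes "0 < r" "\<bar>x\<bar> \<le> x'" "\<bar>y\<bar> \<le> y'"
  shows "pnorm r x y \<le> pnorm r x' y'"
  using assms unfolding pnorm_def by (intro powr_mono2 add_mono add_nonneg_nonneg) simp_all

lemma pnorm_pmean:
  assumes "0 < r" "0 < x" "0 < y"
  shows "pnorm r x y = 2 powr (1 / r) * pmean (ereal r) x y"
proof -
  have "x powr r + y powr r = 2 * ((x powr r + y powr r) / 2)" by simp
  then have "(x powr r + y powr r) powr (1 / r) = 2 powr (1 / r) * ((x powr r + y powr r) / 2) powr (1 / r)"
    by (metis powr_mult zero_le_numeral add_nonneg_nonneg divide_nonneg_pos powr_ge_zero zero_less_numeral)
  then show ?thesis using assms by (simp add: pnorm_def pmean_ereal)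
qed

lemma pnorm_eq_0: "0 < r \<Longrightarrow> pnorm r x y = 0 \<Longrightarrow> x = 0 \<and> y = 0"
  by (simp_all add: pnorm_def add_nonneg_eq_0_iff)

lemma pnorm_powr: "0 < r \<Longrightarrow> pnorm r x y powr r = \<bar>x\<bar> powr r + \<bar>y\<bar> powr r"
  by (simp add: pnorm_def powr_powr)

lemma scaled_powr_sum:
  assumes "0 < r" "0 \<le> x" "0 \<le> y" "0 < pnorm r x y"
  shows "(x / pnorm r x y) powr r + (y / pnorm r x y) powr r = 1"
proof -
  have "0 < pnorm r x y powr r" using assms(4) by simp
  then show ?thesis using assms pnorm_powr[of r x y]
    by (simp add: powr_divide flip: add_divide_distrib)
qed

lemma holder:
  fixes r s :: real
  assumes r: "1 < r" and s: "1 < s" and rs: "1 / r + 1 / s = 1"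
    and nn: "0 \<le> u" "0 \<le> v" "0 \<le> x" "0 \<le> y"
  shows "u * x + v * y \<le> pnorm r u v * pnorm s x y"
proof (cases "pnorm r u v = 0 \<or> pnorm s x y = 0")
  case True
  then show ?thesis using pnorm_eq_0[of r u v] pnorm_eq_0[of s x y] r s by auto
next
  case False
  define M N where "M = pnorm r u v" and "N = pnorm s x y"
  have MN: "0 < M" "0 < N" using False pnorm_nonneg[of r u v] pnorm_nonneg[of s x y]
    by (simp_all add: M_def N_def less_le)
  have "(u / M) * (x / N) \<le> (u / M) powr r / r + (x / N) powr s / s"
    "(v / M) * (y / N) \<le> (v / M) powr r / r + (y / N) powr s / s"
    using MN nn by (intro Youngs_inequality[OF r s rs]; simp)+
  then have "(u * x + v * y) / (M * N)
      \<le> ((u / M) powr r + (v / M) powr r) / r + ((x / N) powr s + (y / N) powr s) / s"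
    by (simp add: add_divide_distrib)
  also have "(u / M) powr r + (v / M) powr r = 1"
    using scaled_powr_sum[of r u v] nn r MN by (simp add: M_def)
  also have "(x / N) powr s + (y / N) powr s = 1"
    using scaled_powr_sum[of s x y] nn s MN by (simp add: N_def)
  finally show ?thesis using MN rs by (simp add: M_def N_def pos_divide_le_eq)
qed

text \<open>The extremal vector in the Hoelder inequality is the normalized vector \<open>(x\<^sup>s\<^sup>-\<^sup>1, y\<^sup>s\<^sup>-\<^sup>1)\<close>. Both the
norms in \<open>upper_lower_radius_le_matrix_bound\<close> and the triangle inequality in \<open>pnorm_matrix_le\<close> are
obtained by this linearization.\<close>

lemma holder_attained:
  fixes r s :: real
  assumes r: "1 < r" and s: "1 < s" and rs: "1 / r + 1 / s = 1" and nn: "0 \<le> x" "0 \<le> y"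
  obtains u v where "0 \<le> u" "0 \<le> v" "pnorm r u v \<le> 1" "u * x + v * y = pnorm s x y"
proof (cases "pnorm s x y = 0")
  case True
  then show ?thesis using that[of 0 0] r by (simp add: pnorm_axis)
next
  case False
  define N where "N = pnorm s x y"
  have N: "0 < N" using False pnorm_nonneg[of s x y] by (simp_all add: N_def less_le)
  have Ns: "N powr s = x powr s + y powr s" using pnorm_powr[of s x y] s nn by (simp add: N_def)
  have e: "(s - 1) * r = s" using rs r s by (simp add: field_simps)
  define f where "f z = (z / N) powr (s - 1)" for z
  have fr: "f z powr r = z powr s / N powr s" if "0 \<le> z" for z
    using that N by (simp add: f_def powr_powr e powr_divide)
  have fz: "f z * z = z powr s / N powr (s - 1)" if "0 \<le> z" for z
  proof (cases "z = 0")
    case False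
    then have "z powr (s - 1) * z powr 1 = z powr s" using that by (subst powr_add[symmetric]) simp
    then show ?thesis using that N False by (simp add: f_def powr_divide)
  qed (use s in simp)
  show ?thesis
  proof (rule that[of "f x" "f y"])
    show "0 \<le> f x" "0 \<le> f y" by (simp_all add: f_def)
    have "f x powr r + f y powr r = 1"
      using scaled_powr_sum[of s x y] s nn N by (simp add: fr N_def powr_divide)
    then show "pnorm r (f x) (f y) \<le> 1" by (simp add: pnorm_def f_def)
    have "f x * x + f y * y = N powr s / N powr (s - 1)"
      using fz nn Ns by (simp add: add_divide_distrib)
    also have "\<dots> = N" using N by (simp flip: powr_diff)
    finally show "f x * x + f y * y = pnorm s x y" by (simp add: N_def)
  qed
qed

text \<open>The vector on the left is \<open>R\<close> times \<open>(x, y)\<close> plus \<open>(y, x)\<close>, so this is the triangle inequality.\<close>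

lemma pnorm_matrix_le:
  assumes r: "1 < r" and s: "1 < s" and rs: "1 / r + 1 / s = 1" and "0 \<le> R" "0 \<le> x" "0 \<le> y"
  shows "pnorm s (R * x + y) (x + R * y) \<le> (R + 1) * pnorm s x y"
proof -
  obtain u v where uv: "0 \<le> u" "0 \<le> v" "pnorm r u v \<le> 1"
    "u * (R * x + y) + v * (x + R * y) = pnorm s (R * x + y) (x + R * y)"
    using holder_attained[OF r s rs, of "R * x + y" "x + R * y"] assms by auto
  have le: "u * z + v * w \<le> pnorm s z w" if "0 \<le> z" "0 \<le> w" for z w
    using holder[OF r s rs uv(1,2) that] uv(3) pnorm_nonneg[of s z w]
    by (meson mult_left_le_one_le order_trans pnorm_nonneg)
  have "u * (R * x + y) + v * (x + R * y) = R * (u * x + v * y) + (u * y + v * x)"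
    by (simp add: algebra_simps)
  also have "\<dots> \<le> R * pnorm s x y + pnorm s y x"
    using assms by (intro add_mono mult_left_mono le)
  finally show ?thesis using uv(4) by (simp add: pnorm_commute[of s y x] distrib_right)
qed

lemma pnorm_le_pnorm:
  assumes "0 < s" "s \<le> r" "0 \<le> x" "0 \<le> y"
  shows "pnorm s x y \<le> 2 powr (1 / s - 1 / r) * pnorm r x y"
proof -
  have one: "1 \<le> 2 powr (1 / s - 1 / r)" using assms by (intro ge_one_powr_ge_zero) (simp_all add: field_simps)
  consider "x = 0" | "y = 0" | "0 < x" "0 < y" using assms by linarith
  then show ?thesis
  proof cases
    case 3
    have "pnorm s x y \<le> 2 powr (1 / s) * pmean (ereal r) x y"
      using assms 3 by (simp add: pnorm_pmean pmean_mono_exponent)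
    also have "\<dots> = 2 powr (1 / s - 1 / r) * pnorm r x y"
      using assms 3 by (simp add: pnorm_pmean flip: powr_add mult.assoc)
    finally show ?thesis .
  qed (use assms mult_right_mono[OF one] in \<open>simp_all add: pnorm_axis\<close>)
qed

lemma mem_unit_ball2: "z \<in> unit_ball2 r \<longleftrightarrow> pnorm r (z $ 1) (z $ 2) \<le> 1"
  by (simp add: unit_ball2_def pnorm_def)

lemma mem_scaled_unit_ball2:
  assumes "0 < r" "0 < c"
  shows "z \<in> (*\<^sub>R) c ` unit_ball2 r \<longleftrightarrow> pnorm r (z $ 1) (z $ 2) \<le> c"
  using assms pnorm_scale[of r "1 / c" "z $ 1" "z $ 2"]
  by (simp add: mem_scaleR_image_iff mem_unit_ball2 pos_divide_le_eq)

text \<open>The matrix of the bound. Applied to \<open>(\<lambda>, \<mu>)\<close> it gives the largest possible gauges of \<open>\<lambda> k + \<mu> l\<close> with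
respect to \<open>K\<close> and \<open>L\<close>, up to the order of the coordinates, for \<open>k\<close> in \<open>K\<close> and \<open>l\<close> in \<open>L\<close>.\<close>

definition mixing :: "real \<Rightarrow> real ^ 2 ^ 2" where
  "mixing R = vector [vector [R, 1], vector [1, R]]"

lemma mixing_nth: "(mixing R *v z) $ 1 = R * z $ 1 + z $ 2" "(mixing R *v z) $ 2 = z $ 1 + R * z $ 2"
  by (simp_all add: mixing_def matrix_vector_mult_def sum_2)

text \<open>Nonnegative vectors suffice because the matrix has nonnegative entries.\<close>

lemma mixing_subset_iff:
  assumes "0 < s" "0 < c" "0 \<le> R"
  shows "(*v) (mixing R) ` unit_ball2 r \<subseteq> (*\<^sub>R) c ` unit_ball2 s \<longleftrightarrow>
    (\<forall>x y. 0 \<le> x \<and> 0 \<le> y \<and> pnorm r x y \<le> 1 \<longrightarrow> pnorm s (R * x + y) (x + R * y) \<le> c)"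
    (is "?S \<longleftrightarrow> ?P")
proof
  assume S: ?S
  show ?P
  proof clarify
    fix x y :: real assume "pnorm r x y \<le> 1"
    then have "mixing R *v vector [x, y] \<in> (*\<^sub>R) c ` unit_ball2 s"
      by (intro subsetD[OF S] imageI) (simp add: mem_unit_ball2)
    then show "pnorm s (R * x + y) (x + R * y) \<le> c"
      using assms by (simp add: mem_scaled_unit_ball2 mixing_nth)
  qed
next
  assume P: ?P
  show ?S
  proof clarify
    fix z :: "real ^ 2" assume "z \<in> unit_ball2 r"
    then have "pnorm r \<bar>z $ 1\<bar> \<bar>z $ 2\<bar> \<le> 1" by (simp add: mem_unit_ball2 pnorm_abs)
    then have "pnorm s (R * \<bar>z $ 1\<bar> + \<bar>z $ 2\<bar>) (\<bar>z $ 1\<bar> + R * \<bar>z $ 2\<bar>) \<le> c" using P by simp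
    moreover have "\<bar>R * z $ 1 + z $ 2\<bar> \<le> R * \<bar>z $ 1\<bar> + \<bar>z $ 2\<bar>"
      using abs_triangle_ineq[of "R * z $ 1" "z $ 2"] by (simp only: abs_mult abs_of_nonneg[OF assms(3)])
    moreover have "\<bar>z $ 1 + R * z $ 2\<bar> \<le> \<bar>z $ 1\<bar> + R * \<bar>z $ 2\<bar>"
      using abs_triangle_ineq[of "z $ 1" "R * z $ 2"] by (simp only: abs_mult abs_of_nonneg[OF assms(3)])
    ultimately have "pnorm s (R * z $ 1 + z $ 2) (z $ 1 + R * z $ 2) \<le> c"
      by (meson pnorm_mono[OF assms(1)] order_trans)
    then show "mixing R *v z \<in> (*\<^sub>R) c ` unit_ball2 s"
      using assms by (simp add: mem_scaled_unit_ball2 mixing_nth)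
  qed
qed

lemma mixing_scale_pos:
  assumes "0 < r" "0 \<le> c" "0 < R" "(*v) (mixing R) ` unit_ball2 r \<subseteq> (*\<^sub>R) c ` unit_ball2 s"
  shows "0 < c"
proof (rule ccontr)
  assume "\<not> 0 < c"
  then have "c = 0" using assms(2) by simp
  have "vector [1, 0] \<in> unit_ball2 r" using assms(1) by (simp add: mem_unit_ball2 pnorm_axis)
  then have "mixing R *v vector [1, 0] \<in> (*\<^sub>R) c ` unit_ball2 s" using assms(4) by blast
  then have "mixing R *v vector [1, 0] = 0" using \<open>c = 0\<close> by auto
  then have "(mixing R *v vector [1, 0]) $ 2 = 0" by simp
  then show False by (simp add: mixing_nth)
qed

lemma mixing_bounded:
  assumes r: "1 < r" and s: "1 < s" and R: "0 < R"
  shows "(*v) (mixing R) ` unit_ball2 r \<subseteq> (*\<^sub>R) ((R + 1) * 2 powr (1 / s)) ` unit_ball2 s"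
proof (subst mixing_subset_iff)
  show "\<forall>x y. 0 \<le> x \<and> 0 \<le> y \<and> pnorm r x y \<le> 1 \<longrightarrow>
      pnorm s (R * x + y) (x + R * y) \<le> (R + 1) * 2 powr (1 / s)"
  proof clarify
    fix x y :: real assume xy: "0 \<le> x" "0 \<le> y" "pnorm r x y \<le> 1"
    have "pnorm r x 0 \<le> pnorm r x y" "pnorm r 0 y \<le> pnorm r x y"
      using xy r by (intro pnorm_mono; simp)+
    then have le: "x \<le> 1" "y \<le> 1" using xy r by (simp_all add: pnorm_axis)
    have Rxy: "R * x \<le> R" "R * y \<le> R" "0 \<le> R * x" "0 \<le> R * y" using le R xy by simp_all
    have "\<bar>R * x + y\<bar> \<le> (R + 1) * 1" "\<bar>x + R * y\<bar> \<le> (R + 1) * 1"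
      using Rxy le xy by (simp_all only: mult_1_right abs_le_iff) linarith+
    then have "pnorm s (R * x + y) (x + R * y) \<le> pnorm s ((R + 1) * 1) ((R + 1) * 1)"
      using s by (intro pnorm_mono) simp_all
    also have "\<dots> = (R + 1) * 2 powr (1 / s)"
      using R s by (subst pnorm_scale) (simp_all add: pnorm_def)
    finally show "pnorm s (R * x + y) (x + R * y) \<le> (R + 1) * 2 powr (1 / s)" .
  qed
qed (use s R in simp_all)

text \<open>This lemma and the next replace the covering radius in the plane by the maximum of a norm, so that
the bodies need no further reference to unit balls.\<close>

lemma matrix_bound_le:
  assumes "1 < P" "Q < -1" "0 < R" "0 < b"
    and "\<And>x y. 0 \<le> x \<Longrightarrow> 0 \<le> y \<Longrightarrow> pnorm (P / (P - 1)) x y \<le> 1 \<Longrightarrow>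
      2 powr (1 / Q - 1 / P) * pnorm (- Q) (R * x + y) (x + R * y) \<le> b"
  shows "matrix_bound P Q R \<le> b"
proof -
  define e where "e = 2 powr (1 / Q - 1 / P)"
  have e: "0 < e" by (simp add: e_def)
  have "covering_radius ((*v) (mixing R) ` unit_ball2 (P / (P - 1))) (unit_ball2 (- Q)) \<le> b / e"
  proof (rule covering_radius_le)
    show "(*v) (mixing R) ` unit_ball2 (P / (P - 1)) \<subseteq> (*\<^sub>R) (b / e) ` unit_ball2 (- Q)"
      using assms e by (subst mixing_subset_iff) (simp_all add: pos_le_divide_eq mult.commute e_def)
  qed (use e assms in simp_all)
  then show ?thesis using e
    by (simp add: matrix_bound_def mixing_def[symmetric] e_def[symmetric] pos_le_divide_eq mult.commute)
qed

lemma matrix_bound_ge: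
  assumes PQ: "1 < P" "Q < -1" and R: "0 < R"
    and b: "\<And>c. 0 < c \<Longrightarrow>
      (\<And>x y. 0 \<le> x \<Longrightarrow> 0 \<le> y \<Longrightarrow> pnorm (P / (P - 1)) x y \<le> 1 \<Longrightarrow>
        pnorm (- Q) (R * x + y) (x + R * y) \<le> c) \<Longrightarrow>
      b \<le> 2 powr (1 / Q - 1 / P) * c"
  shows "b \<le> matrix_bound P Q R"
proof -
  define e where "e = 2 powr (1 / Q - 1 / P)"
  have e: "0 < e" by (simp add: e_def)
  have r: "1 < P / (P - 1)" using PQ by simp
  have "b / e \<le> covering_radius ((*v) (mixing R) ` unit_ball2 (P / (P - 1))) (unit_ball2 (- Q))"
  proof (rule covering_radius_ge[OF _ mixing_bounded])
    fix c assume c: "0 \<le> c" "(*v) (mixing R) ` unit_ball2 (P / (P - 1)) \<subseteq> (*\<^sub>R) c ` unit_ball2 (- Q)"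
    have "0 < c" using mixing_scale_pos[OF _ c(1) R c(2)] r by simp
    then have "b \<le> e * c" unfolding e_def using c(2) PQ R
      by (intro b) (simp_all add: mixing_subset_iff)
    then show "b / e \<le> c" using e by (simp add: pos_divide_le_eq mult.commute)
  qed (use r PQ R in simp_all)
  then show ?thesis using e
    by (simp add: matrix_bound_def mixing_def[symmetric] e_def[symmetric] pos_divide_le_eq mult.commute)
qed

lemma conj_exponent:
  fixes P :: real
  assumes "1 < P"
  shows "1 < P / (P - 1)" "1 / P + 1 / (P / (P - 1)) = 1" "1 / (P / (P - 1)) + 1 / P = 1"
  using assms by (simp_all add: field_simps)

text \<open>Let \<open>r = P / (P - 1)\<close> and \<open>s = -Q \<le> r\<close>. The triangle inequality and the comparison of the \<open>s\<close>-norm with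
the \<open>r\<close>-norm are equalities for vectors on the diagonal, so the maximum is at \<open>2\<^sup>-\<^sup>1\<^sup>/\<^sup>r (1, 1)\<close>.\<close>

lemma matrix_bound_eq:
  assumes PQ: "1 < P" "Q < -1" and R: "0 < R" and le: "- Q \<le> P / (P - 1)"
  shows "matrix_bound P Q R = (R + 1) / 2"
proof (rule antisym)
  define r s where "r = P / (P - 1)" and "s = - Q"
  have s: "1 < s" using PQ by (simp add: s_def)
  have r: "1 < r" "1 / r = 1 - 1 / P" using PQ by (simp_all add: r_def field_simps)
  have ex: "2 powr (1 / Q - 1 / P) * (2 powr (1 / s - 1 / r) * z) = z / 2" for z :: real
  proof -
    have "2 powr (1 / Q - 1 / P) * 2 powr (1 / s - 1 / r) = 2 powr (- 1 :: real)"
      using PQ r(2) by (subst powr_add[symmetric]) (simp add: s_def)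
    then show ?thesis by (simp add: powr_minus flip: mult.assoc)
  qed
  show "matrix_bound P Q R \<le> (R + 1) / 2"
  proof (rule matrix_bound_le[OF PQ R])
    fix x y :: real assume xy: "0 \<le> x" "0 \<le> y" "pnorm (P / (P - 1)) x y \<le> 1"
    have "pnorm s (R * x + y) (x + R * y) \<le> (R + 1) * pnorm s x y"
      by (rule pnorm_matrix_le[OF conj_exponent(1)[OF s] s conj_exponent(3)[OF s] less_imp_le[OF R] xy(1,2)])
    also have "\<dots> \<le> (R + 1) * (2 powr (1 / s - 1 / r) * pnorm r x y)"
      using R s xy le by (intro mult_left_mono pnorm_le_pnorm) (simp_all add: r_def s_def)
    also have "\<dots> \<le> (R + 1) * (2 powr (1 / s - 1 / r) * 1)"
      using R xy by (intro mult_left_mono) (simp_all add: r_def)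
    finally have "pnorm s (R * x + y) (x + R * y) \<le> 2 powr (1 / s - 1 / r) * (R + 1)"
      by (simp add: mult.commute)
    then have "2 powr (1 / Q - 1 / P) * pnorm s (R * x + y) (x + R * y)
        \<le> 2 powr (1 / Q - 1 / P) * (2 powr (1 / s - 1 / r) * (R + 1))"
      by (intro mult_left_mono) simp_all
    then show "2 powr (1 / Q - 1 / P) * pnorm (- Q) (R * x + y) (x + R * y) \<le> (R + 1) / 2"
      unfolding ex by (simp add: s_def)
  qed (use R in simp_all)
  show "(R + 1) / 2 \<le> matrix_bound P Q R"
  proof (rule matrix_bound_ge[OF PQ R])
    fix c :: real assume c: "0 < c" and *: "\<And>x y. 0 \<le> x \<Longrightarrow> 0 \<le> y \<Longrightarrow> pnorm (P / (P - 1)) x y \<le> 1 \<Longrightarrow>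
        pnorm (- Q) (R * x + y) (x + R * y) \<le> c"
    define t :: real where "t = 2 powr (- (1 / r))"
    have t: "0 \<le> t" by (simp add: t_def)
    have one: "pnorm a 1 1 = 2 powr (1 / a)" for a by (simp add: pnorm_def)
    have "pnorm r t t = t * 2 powr (1 / r)"
      using pnorm_scale[of r t 1 1] r t one by simp
    also have "\<dots> = 1" by (simp add: t_def powr_minus)
    finally have "pnorm s (R * t + t) (t + R * t) \<le> c" using *[OF t t] by (simp add: r_def s_def)
    moreover have "pnorm s (R * t + t) (t + R * t) = (R + 1) * t * 2 powr (1 / s)"
      using pnorm_scale[of s "(R + 1) * t" 1 1] s R t one[of s] by (simp add: algebra_simps)
    moreover have "(R + 1) * t * 2 powr (1 / s) = 2 powr (1 / s - 1 / r) * (R + 1)"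
      by (simp add: t_def powr_minus powr_diff field_simps)
    ultimately have "2 powr (1 / Q - 1 / P) * (2 powr (1 / s - 1 / r) * (R + 1)) \<le> 2 powr (1 / Q - 1 / P) * c"
      by (intro mult_left_mono) simp_all
    then show "(R + 1) / 2 \<le> 2 powr (1 / Q - 1 / P) * c" using ex[of "R + 1"] by simp
  qed
qed

text \<open>The supporting hyperplane of \<open>K\<close> at the boundary point \<open>x / \<parallel>x\<parallel>\<^sub>K\<close>, normalized to be \<open>1\<close> there.\<close>

lemma gauge_functional:
  fixes K :: "(real ^ 'n) set"
  assumes K: "K \<in> bodies0" and x: "x \<noteq> 0"
  shows "\<exists>a. (\<forall>y\<in>K. a \<bullet> y \<le> 1) \<and> a \<bullet> x = gauge_fn K x"
proof -
  define g where "g = gauge_fn K x"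
  have g: "0 < g" using gauge_pos[OF K x] by (simp add: g_def)
  define w where "w = (1 / g) *\<^sub>R x"
  have w: "w \<in> K" using gauge_mem[OF K, of x] g by (simp add: w_def g_def mem_scaleR_image_iff)
  have "w \<notin> interior K"
  proof
    assume "w \<in> interior K"
    then obtain e where e: "e > 0" "cball w e \<subseteq> K" by (auto simp: mem_interior_cball)
    \<comment> \<open>Otherwise the slightly larger multiple \<open>(1 + d) w\<close> would still lie in \<open>K\<close>.\<close>
    define d where "d = e / norm w"
    have nw: "0 < norm w" using x g by (simp add: w_def)
    then have d: "0 < d" using e by (simp add: d_def)
    have "(1 + d) *\<^sub>R w \<in> cball w e" using d nw e by (simp add: dist_norm algebra_simps d_def)
    then have "(1 / (g / (1 + d))) *\<^sub>R x \<in> K" using e(2) by (auto simp: w_def)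
    then have "g \<le> g / (1 + d)" using d g unfolding g_def by (intro gauge_le_if_scaled) simp_all
    moreover have "0 < g * d" using d g by simp
    ultimately show False using d by (simp add: pos_le_divide_eq distrib_left)
  qed
  then obtain a b where ab: "a \<noteq> 0" "\<And>z. z \<in> interior K \<Longrightarrow> a \<bullet> z \<le> b" "b \<le> a \<bullet> w"
    using separating_hyperplane_sets[of "interior K" "{w}"] bodies0D(2)[OF K] K
    by (auto simp: bodies0_def)
  have "closure (interior K) = K"
    using K bodies0D[OF K] convex_closure_interior[of K] by (auto simp: bodies0_def)
  then have le: "a \<bullet> z \<le> a \<bullet> w" if "z \<in> K" for z
    using that ab(2,3) closure_minimal[of "interior K" "{z. a \<bullet> z \<le> b}"] closed_halfspace_le
    by fastforce
  obtain e where e: "e > 0" "cball 0 e \<subseteq> K" using bodies0_ball K by blast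
  then have "(e / norm a) *\<^sub>R a \<in> K" using ab(1) by auto
  then have "a \<bullet> ((e / norm a) *\<^sub>R a) \<le> a \<bullet> w" by (rule le)
  moreover have "0 < a \<bullet> ((e / norm a) *\<^sub>R a)" using ab(1) e(1) by simp
  ultimately have pos: "0 < a \<bullet> w" by linarith
  have "((1 / (a \<bullet> w)) *\<^sub>R a) \<bullet> x = g" using pos g by (auto simp: w_def)
  moreover have "((1 / (a \<bullet> w)) *\<^sub>R a) \<bullet> y \<le> 1" if "y \<in> K" for y
    using le[OF that] pos by simp
  ultimately show ?thesis unfolding g_def by blast
qed

text \<open>Homogeneity extends the inequalities defining the upper mean from unit vectors to all functionals.\<close>

lemma upper_mean_inner_le_pmean:
  fixes K L :: "(real ^ 'n) set"
  assumes K: "K \<in> bodies0" and L: "L \<in> bodies0" and x: "x \<in> upper_mean p K L"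
    and st: "0 < s" "0 < t" "\<And>y. y \<in> K \<Longrightarrow> c \<bullet> y \<le> s" "\<And>y. y \<in> L \<Longrightarrow> c \<bullet> y \<le> t"
  shows "c \<bullet> x \<le> pmean p s t"
proof (cases "c = 0")
  case True
  then show ?thesis using pmean_pos[OF st(1,2), of p] by simp
next
  case False
  define n where "n = norm c"
  have n: "0 < n" using False by (simp add: n_def)
  define u where "u = (1 / n) *\<^sub>R c"
  have u: "u \<in> sphere 0 1" using n by (simp add: u_def n_def)
  have "support_fn K u \<le> (1 / n) * s" "support_fn L u \<le> (1 / n) * t"
    using n st(3,4) bodies0D(5)[OF K] bodies0D(5)[OF L]
    by (auto intro!: support_least simp: u_def divide_right_mono)
  then have "u \<bullet> x \<le> pmean p ((1 / n) * s) ((1 / n) * t)"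
    using upper_mean_inner_le[OF x u] support_pos[OF K u] support_pos[OF L u]
    by (meson pmean_mono order_trans)
  also have "\<dots> = (1 / n) * pmean p s t" using n st by (intro pmean_scale) simp_all
  finally show ?thesis using n by (simp add: u_def divide_le_cancel)
qed


lemma upper_lower_radius_le_matrix_bound:
  fixes K L :: "(real ^ 'n) set"
  assumes K: "K \<in> bodies0" and L: "L \<in> bodies0" and dist: "covering_distance K L = R"
    and PQ: "1 < P" "Q < -1"
  shows "covering_radius (upper_mean (ereal P) K L) (lower_mean (ereal Q) K L) \<le> matrix_bound P Q R"
proof (rule matrix_bound_ge[OF PQ dist_pos[OF K L dist]])
  fix c :: real
  assume c: "0 < c" and mix: "\<And>x y. 0 \<le> x \<Longrightarrow> 0 \<le> y \<Longrightarrow> pnorm (P / (P - 1)) x y \<le> 1 \<Longrightarrow>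
        pnorm (- Q) (R * x + y) (x + R * y) \<le> c"
  define e where "e = 2 powr (1 / Q - 1 / P)"
  define s where "s = - Q"
  have s: "1 < s" using PQ by (simp add: s_def)
  have "upper_mean (ereal P) K L \<subseteq> (*\<^sub>R) (e * c) ` lower_mean (ereal Q) K L"
  proof
    fix x assume x: "x \<in> upper_mean (ereal P) K L"
    show "x \<in> (*\<^sub>R) (e * c) ` lower_mean (ereal Q) K L"
    proof (rule lower_mean_intro[OF K L])
      show "0 < e * c" using c by (simp add: e_def)
      assume x0: "x \<noteq> 0"
      have g: "0 < gauge_fn K x" "0 < gauge_fn L x" using K L x0 by (simp_all add: gauge_pos)
      define s' where "s' = s / (s - 1)"
      note s' = conj_exponent[OF s, folded s'_def]
      obtain \<alpha> \<beta> where ab: "0 \<le> \<alpha>" "0 \<le> \<beta>" "pnorm s' \<alpha> \<beta> \<le> 1"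
        "\<alpha> * gauge_fn K x + \<beta> * gauge_fn L x = pnorm s (gauge_fn K x) (gauge_fn L x)"
        using holder_attained[OF s'(1) s s'(3), of "gauge_fn K x" "gauge_fn L x"] g by auto
      have pos: "0 < pnorm s (gauge_fn K x) (gauge_fn L x)"
        using g s by (simp add: pnorm_pmean pmean_pos)
      have "\<alpha> \<noteq> 0 \<or> \<beta> \<noteq> 0" using ab(4) pos by auto
      then have st: "0 < \<alpha> + R * \<beta>" "0 < R * \<alpha> + \<beta>"
        using ab(1,2) mult_right_mono[OF dist_ge_1[OF K L dist] ab(1)] mult_right_mono[OF dist_ge_1[OF K L dist] ab(2)] by linarith+
      obtain a b where a: "\<And>y. y \<in> K \<Longrightarrow> a \<bullet> y \<le> 1" "a \<bullet> x = gauge_fn K x"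
        and b: "\<And>y. y \<in> L \<Longrightarrow> b \<bullet> y \<le> 1" "b \<bullet> x = gauge_fn L x"
        using gauge_functional[OF K x0] gauge_functional[OF L x0] by metis
      have aL: "a \<bullet> y \<le> R" if "y \<in> L" for y
      proof -
        obtain z where "z \<in> K" "y = R *\<^sub>R z" using dist_covers(2)[OF K L dist] \<open>y \<in> L\<close> by blast
        then show ?thesis using a(1)[of z] dist_pos[OF K L dist] by simp
      qed
      have bK: "b \<bullet> y \<le> R" if "y \<in> K" for y
      proof -
        obtain z where "z \<in> L" "y = R *\<^sub>R z" using dist_covers(1)[OF K L dist] \<open>y \<in> K\<close> by blast
        then show ?thesis using b(1)[of z] dist_pos[OF K L dist] by simp
      qed
      have "pnorm s (gauge_fn K x) (gauge_fn L x) = (\<alpha> *\<^sub>R a + \<beta> *\<^sub>R b) \<bullet> x"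
        using ab(4) a(2) b(2) by (simp add: inner_add_left)
      also have "\<dots> \<le> pmean (ereal P) (\<alpha> + R * \<beta>) (R * \<alpha> + \<beta>)"
      proof (rule upper_mean_inner_le_pmean[OF K L x st])
        fix y assume y: "y \<in> K"
        show "(\<alpha> *\<^sub>R a + \<beta> *\<^sub>R b) \<bullet> y \<le> \<alpha> + R * \<beta>"
          using mult_left_mono[OF a(1)[OF y] ab(1)] mult_left_mono[OF bK[OF y] ab(2)]
          by (simp add: inner_add_left mult.commute)
      next
        fix y assume y: "y \<in> L"
        show "(\<alpha> *\<^sub>R a + \<beta> *\<^sub>R b) \<bullet> y \<le> R * \<alpha> + \<beta>"
          using mult_left_mono[OF aL[OF y] ab(1)] mult_left_mono[OF b(1)[OF y] ab(2)]
          by (simp add: inner_add_left mult.commute)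
      qed
      also have "\<dots> = 2 powr (- (1 / P)) * pnorm P (\<alpha> + R * \<beta>) (R * \<alpha> + \<beta>)"
        using PQ st by (simp add: pnorm_pmean powr_minus)
      also have "pnorm P (\<alpha> + R * \<beta>) (R * \<alpha> + \<beta>) \<le> c"
      proof -
        obtain u v where uv: "0 \<le> u" "0 \<le> v" "pnorm (P / (P - 1)) u v \<le> 1"
          "u * (\<alpha> + R * \<beta>) + v * (R * \<alpha> + \<beta>) = pnorm P (\<alpha> + R * \<beta>) (R * \<alpha> + \<beta>)"
          using holder_attained[OF conj_exponent(1)[OF PQ(1)] PQ(1) conj_exponent(3)[OF PQ(1)],
              of "\<alpha> + R * \<beta>" "R * \<alpha> + \<beta>"] st by auto
        \<comment> \<open>The matrix is symmetric, so it can be moved from \<open>(\<alpha>, \<beta>)\<close> to \<open>(u, v)\<close>.\<close>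
        have "u * (\<alpha> + R * \<beta>) + v * (R * \<alpha> + \<beta>) = \<beta> * (R * u + v) + \<alpha> * (u + R * v)"
          by (simp add: algebra_simps)
        also have "\<dots> \<le> pnorm s' \<beta> \<alpha> * pnorm s (R * u + v) (u + R * v)"
          using uv dist_pos[OF K L dist] ab by (intro holder[OF s'(1) s s'(3)]) simp_all
        also have "\<dots> \<le> 1 * pnorm s (R * u + v) (u + R * v)"
          using ab(3) by (intro mult_right_mono pnorm_nonneg) (simp add: pnorm_commute)
        also have "\<dots> \<le> c" using mix[OF uv(1-3)] by (simp add: s_def)
        finally show ?thesis using uv(4) by simp
      qed
      finally have "pnorm s (gauge_fn K x) (gauge_fn L x) \<le> 2 powr (- (1 / P)) * c"
        by (simp add: mult_left_mono)
      then have "2 powr (1 / Q) * pnorm s (gauge_fn K x) (gauge_fn L x)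
          \<le> 2 powr (1 / Q) * (2 powr (- (1 / P)) * c)" by (intro mult_left_mono) simp_all
      moreover have "2 powr (1 / Q) * (2 powr (- (1 / P)) * c) = e * c"
        by (simp add: e_def flip: powr_add mult.assoc)
      moreover have "2 powr (1 / Q) * pnorm s (gauge_fn K x) (gauge_fn L x)
          = pmean (ereal s) (gauge_fn K x) (gauge_fn L x)"
        using s g by (simp add: pnorm_pmean s_def flip: powr_add mult.assoc)
      ultimately show "pmean (- ereal Q) (gauge_fn K x) (gauge_fn L x) \<le> e * c"
        by (simp add: s_def)
    qed
  qed
  then show "covering_radius (upper_mean (ereal P) K L) (lower_mean (ereal Q) K L)
      \<le> 2 powr (1 / Q - 1 / P) * c"
    using c by (intro covering_radius_le) (simp_all add: e_def)
qed

section \<open>Bodies whose reflections attain the bounds\<close>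

lemma bodies0_uminus: "K \<in> bodies0 \<Longrightarrow> uminus ` K \<in> bodies0"
  by (simp_all add: bodies0_def compact_negations convex_negations interior_negations)

lemma covering_radius_uminus: "covering_radius (uminus ` X) (uminus ` Y) = covering_radius X Y"
proof -
  have "(*\<^sub>R) l ` uminus ` Y = uminus ` (*\<^sub>R) l ` Y" for l by (simp add: image_image)
  then have "uminus ` X \<subseteq> (*\<^sub>R) l ` uminus ` Y \<longleftrightarrow> X \<subseteq> (*\<^sub>R) l ` Y" for l
    by (simp add: inj_image_subset_iff)
  then show ?thesis by (simp add: covering_radius_def)
qed

lemma covering_distance_uminus:
  "covering_distance K (uminus ` K) = covering_radius K (uminus ` K)"
  using covering_radius_uminus[of K "uminus ` K"] by (simp add: covering_distance_def image_image)

text \<open>The functional \<open>c\<close> has the value \<open>R\<close> on \<open>K\<close>, but at most \<open>1\<close> on \<open>-K\<close>.\<close>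

lemma covering_distance_reflection:
  fixes K :: "(real ^ 'n) set"
  assumes R: "1 \<le> R" and cov: "\<And>x. x \<in> K \<Longrightarrow> - ((1 / R) *\<^sub>R x) \<in> K"
    and w: "w \<in> K" "c \<bullet> w = R" and c: "\<And>y. y \<in> K \<Longrightarrow> - 1 \<le> c \<bullet> y"
  shows "covering_distance K (uminus ` K) = R"
  unfolding covering_distance_uminus
proof (rule covering_radius_eq)
  have "(1 / R) *\<^sub>R x \<in> uminus ` K" if "x \<in> K" for x
    using imageI[OF cov[OF that], of uminus] by simp
  then show "K \<subseteq> (*\<^sub>R) R ` uminus ` K" using R by (auto simp: mem_scaleR_image_iff)
  fix l assume l: "0 \<le> l" "K \<subseteq> (*\<^sub>R) l ` uminus ` K"
  then obtain y where y: "y \<in> K" "w = l *\<^sub>R (- y)" using w(1) by blast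
  have "R = l * - (c \<bullet> y)" using w(2) by (simp add: y(2))
  also have "\<dots> \<le> l * 1" using c[OF y(1)] l by (intro mult_left_mono) simp_all
  finally show "R \<le> l" by simp
qed (use R in simp_all)

lemma bodies0_cbox:
  fixes a b :: "real ^ 'n"
  assumes "\<And>k. a $ k < 0" "\<And>k. 0 < b $ k"
  shows "cbox a b \<in> bodies0"
  using assms by (simp_all add: bodies0_def interior_cbox mem_box_cart)

lemma inner_axis_1: "axis i 1 \<bullet> x = x $ i" for x :: "real ^ 'n"
  by (simp add: inner_axis' )

lemma axis_1_nth: "axis i 1 $ k = (if k = i then 1 else 0)"
  by (simp add: axis_def)

text \<open>For \<open>j \<noteq> i\<close> this box shares with its reflection the slab \<open>\<bar>x $ j\<bar> \<le> 1\<close>, and the point \<open>axis j 1\<close> on its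
boundary. So the radii cannot drop below \<open>1\<close>, while the \<open>i\<close>-th coordinate produces the covering
distance \<open>R\<close>.\<close>

definition one_sided_box :: "'n \<Rightarrow> real \<Rightarrow> (real ^ 'n) set" where
  "one_sided_box i R = cbox (\<chi> k. if k = i then - R else - 1) (\<chi> k. 1)"

text \<open>On this box the \<open>i\<close>-th coordinate is at most \<open>1\<close>, and on its reflection the \<open>j\<close>-th coordinate is. The
point with these coordinates equal to \<open>(1, R)\<close> is in the box and the one with \<open>(R, 1)\<close> in its
reflection, so their combinations have the largest gauges that the covering distance permits.\<close>

definition two_sided_box :: "'n \<Rightarrow> 'n \<Rightarrow> real \<Rightarrow> (real ^ 'n) set" where
  "two_sided_box i j R = cbox (\<chi> k. if k = i then - R else - 1) (\<chi> k. if k = j then R else 1)"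

text \<open>In the coordinates \<open>i\<close> and \<open>j\<close> this is the quadrilateral with vertices \<open>(R, 0)\<close>, \<open>(-1, 0)\<close>, \<open>(0, 1)\<close> and
\<open>(0, -R)\<close>, a multiple of the polar of the planar two-sided box. Polarity exchanges upper and lower
means and replaces \<open>(p, q)\<close> by \<open>(-q, -p)\<close>, which leads from \<open>p \<le> 1, q \<le> -1\<close> to \<open>p \<ge> 1, q \<ge> -1\<close>.\<close>

definition kite_prism :: "'n \<Rightarrow> 'n \<Rightarrow> real \<Rightarrow> (real ^ 'n) set" where
  "kite_prism i j R = {x. x $ i + R * x $ j \<le> R \<and> x $ i - x $ j \<le> R \<and> x $ j - x $ i \<le> 1
     \<and> - (R * x $ i) - x $ j \<le> R \<and> (\<forall>k. k \<noteq> i \<and> k \<noteq> j \<longrightarrow> \<bar>x $ k\<bar> \<le> 1)}"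

lemma mem_one_sided_box:
  "1 \<le> R \<Longrightarrow> x \<in> one_sided_box i R \<longleftrightarrow> (\<forall>k. (if k = i then - R else - 1) \<le> x $ k \<and> x $ k \<le> 1)"
  by (simp add: one_sided_box_def mem_box_cart)

lemma mem_two_sided_box:
  "x \<in> two_sided_box i j R \<longleftrightarrow>
    (\<forall>k. (if k = i then - R else - 1) \<le> x $ k \<and> x $ k \<le> (if k = j then R else 1))"
  by (simp add: two_sided_box_def mem_box_cart)

lemma one_sided_box_bodies0: "1 \<le> R \<Longrightarrow> one_sided_box i R \<in> bodies0"
  unfolding one_sided_box_def by (rule bodies0_cbox) simp_all

lemma two_sided_box_bodies0: "1 \<le> R \<Longrightarrow> two_sided_box i j R \<in> bodies0"
  unfolding two_sided_box_def by (rule bodies0_cbox) simp_all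

lemma covering_distance_one_sided_box:
  assumes "1 \<le> R"
  shows "covering_distance (one_sided_box i R) (uminus ` one_sided_box i R) = R"
proof (rule covering_distance_reflection[OF assms, where w = "- R *\<^sub>R axis i 1" and c = "- axis i 1"])
  fix x assume "x \<in> one_sided_box i R"
  then have x: "(if k = i then - R else - 1) \<le> x $ k" "x $ k \<le> 1" for k
    using assms by (simp_all add: mem_one_sided_box)
  have le: "- R \<le> x $ k" for k using x(1)[of k] assms by (auto split: if_splits)
  have "- 1 \<le> - (x $ k / R)" "- (x $ k / R) \<le> 1" for k
    using x(2)[of k] le[of k] assms by (simp_all add: field_simps)
  moreover from this have "- R \<le> - (x $ k / R)" for k using assms by (meson neg_le_iff_le order_trans)
  ultimately show "- ((1 / R) *\<^sub>R x) \<in> one_sided_box i R"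
    using assms by (simp_all add: mem_one_sided_box)
  show "- 1 \<le> - axis i 1 \<bullet> x" using x(2)[of i] by (simp add: inner_axis_1)
next
  show "- R *\<^sub>R axis i 1 \<in> one_sided_box i R"
    using assms by (simp_all add: mem_one_sided_box axis_def)
qed (simp add: inner_axis_1)

lemma covering_distance_two_sided_box:
  assumes "1 \<le> R" "i \<noteq> j"
  shows "covering_distance (two_sided_box i j R) (uminus ` two_sided_box i j R) = R"
proof (rule covering_distance_reflection[OF assms(1), where w = "- R *\<^sub>R axis i 1" and c = "- axis i 1"])
  fix x assume "x \<in> two_sided_box i j R"
  then have x: "(if k = i then - R else - 1) \<le> x $ k" "x $ k \<le> (if k = j then R else 1)" for k
    by (simp_all add: mem_two_sided_box)
  have le: "- R \<le> x $ k" "x $ k \<le> R" for k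
    using x[of k] assms by (auto split: if_splits)
  have "- 1 \<le> - (x $ k / R)" "- (x $ k / R) \<le> 1" for k
    using le[of k] assms by (simp_all add: field_simps)
  moreover from this have "- R \<le> - (x $ k / R)" "- (x $ k / R) \<le> R" for k
    using assms(1) by (meson neg_le_iff_le order_trans)+
  ultimately show "- ((1 / R) *\<^sub>R x) \<in> two_sided_box i j R"
    using assms by (simp_all add: mem_two_sided_box)
  show "- 1 \<le> - axis i 1 \<bullet> x" using x(2)[of i] assms by (simp add: inner_axis_1)
next
  show "- R *\<^sub>R axis i 1 \<in> two_sided_box i j R"
    using assms by (simp_all add: mem_two_sided_box axis_def)
qed (simp add: inner_axis_1)

lemma kite_bounds:
  assumes R: "1 \<le> R" and x: "x \<in> kite_prism i j R"
  shows "- 1 \<le> x $ i" "x $ i \<le> R" "- R \<le> x $ j" "x $ j \<le> 1"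
proof -
  have f: "x $ i + R * x $ j \<le> R" "x $ i - x $ j \<le> R" "x $ j - x $ i \<le> 1" "- (R * x $ i) - x $ j \<le> R"
    using x by (simp_all add: kite_prism_def)
  have pos: "0 < R + 1" using R by simp
  have "(R + 1) * (- 1) \<le> (R + 1) * x $ i" "(R + 1) * x $ j \<le> (R + 1) * 1"
    using f by (simp_all add: distrib_right)
  then show i: "- 1 \<le> x $ i" and j: "x $ j \<le> 1" using pos by (simp_all only: mult_le_cancel_left_pos)
  \<comment> \<open>The other two bounds eliminate one coordinate between two facet inequalities in the same way.\<close>
  have "R * (x $ i - x $ j) \<le> R * R" using f(2) R by (intro mult_left_mono) simp_all
  then have "(R + 1) * x $ i \<le> (R + 1) * R" "(R + 1) * (- R) \<le> (R + 1) * x $ j"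
    using f by (simp_all add: algebra_simps)
  then show "x $ i \<le> R" "- R \<le> x $ j" using pos by (simp_all only: mult_le_cancel_left_pos)
qed

lemma kite_prism_bodies0:
  fixes i j :: "'n :: finite"
  assumes R: "1 \<le> R" 
  shows "kite_prism i j R \<in> bodies0"
proof -
  have eq: "kite_prism i j R = {x. x $ i + R * x $ j \<le> R} \<inter> {x. x $ i - x $ j \<le> R}
      \<inter> {x. x $ j - x $ i \<le> 1} \<inter> {x. - (R * x $ i) - x $ j \<le> R}
      \<inter> (\<Inter>k\<in>- {i, j}. {x. x $ k \<le> 1} \<inter> {x. - (x $ k) \<le> 1})"
    by (auto simp: kite_prism_def abs_le_iff)
  have half: "{x :: real ^ 'n. x $ i + R * x $ j \<le> R} = {x. (axis i 1 + R *\<^sub>R axis j 1) \<bullet> x \<le> R}"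
    "{x :: real ^ 'n. x $ i - x $ j \<le> R} = {x. (axis i 1 - axis j 1) \<bullet> x \<le> R}"
    "{x :: real ^ 'n. x $ j - x $ i \<le> 1} = {x. (axis j 1 - axis i 1) \<bullet> x \<le> 1}"
    "{x :: real ^ 'n. - (R * x $ i) - x $ j \<le> R} = {x. (- (R *\<^sub>R axis i 1) - axis j 1) \<bullet> x \<le> R}"
    "{x :: real ^ 'n. x $ k \<le> 1} = {x. axis k 1 \<bullet> x \<le> 1}"
    "{x :: real ^ 'n. - (x $ k) \<le> 1} = {x. - axis k 1 \<bullet> x \<le> 1}" for k
    by (simp_all add: inner_add_left inner_diff_left inner_axis_1)
  have "closed (kite_prism i j R)" "convex (kite_prism i j R)"
    unfolding eq half by (intro closed_Int closed_INT ballI closed_halfspace_le convex_Int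
        convex_INT convex_halfspace_le)+
  moreover have "bounded (kite_prism i j R)"
  proof (rule bounded_subset)
    show "bounded (cbox (\<chi> k. - R) (\<chi> k. R) :: (real ^ 'n) set)" by (rule bounded_cbox)
    show "kite_prism i j R \<subseteq> cbox (\<chi> k. - R) (\<chi> k. R)"
    proof
      fix x assume x: "x \<in> kite_prism i j R"
      have "- R \<le> x $ k \<and> x $ k \<le> R" for k
      proof (cases "k = i \<or> k = j")
        case False
        then have "\<bar>x $ k\<bar> \<le> 1" using x by (simp_all add: kite_prism_def)
        then show ?thesis using R by auto
      qed (use kite_bounds[OF R x] R in auto)
      then show "x \<in> cbox (\<chi> k. - R) (\<chi> k. R)" by (simp add: mem_box_cart)
    qed
  qed
  moreover have "0 \<in> interior (kite_prism i j R)"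
  proof (rule interiorI)
    show "ball 0 (1 / 2) \<subseteq> kite_prism i j R"
    proof
      fix x :: "real ^ 'n" assume "x \<in> ball 0 (1 / 2)"
      then have k: "\<bar>x $ k\<bar> \<le> 1 / 2" for k using component_le_norm_cart[of x k] by simp
      have k1: "\<bar>x $ k\<bar> \<le> 1" for k using k[of k] by linarith
      have "\<bar>R * x $ k\<bar> \<le> R * (1 / 2)" for k
        using R mult_left_mono[OF k[of k], of R] by (simp add: abs_mult)
      note R2 = this[of i] this[of j]
      have "x $ i + R * x $ j \<le> R" "x $ i - x $ j \<le> R" "x $ j - x $ i \<le> 1"
        "- (R * x $ i) - x $ j \<le> R"
        using R abs_le_D1[OF R2(1)] abs_le_D2[OF R2(1)] abs_le_D1[OF R2(2)] abs_le_D2[OF R2(2)]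
          abs_le_D1[OF k[of i]] abs_le_D2[OF k[of i]] abs_le_D1[OF k[of j]] abs_le_D2[OF k[of j]]
        by linarith+
      then show "x \<in> kite_prism i j R" using k1 by (simp add: kite_prism_def)
    qed
  qed simp_all
  ultimately show ?thesis by (simp add: bodies0_def compact_eq_bounded_closed)
qed

lemma covering_distance_kite_prism:
  assumes R: "1 \<le> R" and ij: "i \<noteq> j"
  shows "covering_distance (kite_prism i j R) (uminus ` kite_prism i j R) = R"
proof (rule covering_distance_reflection[OF assms(1), where w = "R *\<^sub>R axis i 1" and c = "axis i 1"])
  fix x assume x: "x \<in> kite_prism i j R"
  then have f: "x $ i + R * x $ j \<le> R" "x $ i - x $ j \<le> R" "x $ j - x $ i \<le> 1"
    "- (R * x $ i) - x $ j \<le> R" by (simp_all add: kite_prism_def)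
  note b = kite_bounds[OF R x]
  have RR: "1 * 1 \<le> R * R" using R by (intro mult_mono) simp_all
  \<comment> \<open>Two of the inequalities for \<open>- x / R\<close> combine two facet inequalities for \<open>x\<close>, the one with normal \<open>(1, -1)\<close> having weight \<open>R - 1\<close>.\<close>
  have "(R - 1) * (x $ i - x $ j) \<le> (R - 1) * R" using f(2) R by (intro mult_left_mono) simp_all
  then have m: "R * x $ i - R * x $ j - x $ i + x $ j \<le> R * R - R" by (simp add: algebra_simps)
  have "- (x $ i) - R * x $ j \<le> R * R" "x $ j - x $ i \<le> R * R" "x $ i - x $ j \<le> R * 1"
    "R * x $ i + x $ j \<le> R * R"
    using f m RR by linarith+
  moreover have "\<bar>x $ k\<bar> \<le> R" if "k \<noteq> i" "k \<noteq> j" for k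
  proof -
    have "\<bar>x $ k\<bar> \<le> 1" using x that by (simp add: kite_prism_def)
    then show ?thesis using R by linarith
  qed
  ultimately show "- ((1 / R) *\<^sub>R x) \<in> kite_prism i j R"
    using R by (simp_all add: kite_prism_def field_simps)
  show "- 1 \<le> axis i 1 \<bullet> x" using b(1) by (simp add: inner_axis_1)
next
  have "- (R * R) \<le> R" using R zero_le_square[of R] by linarith
  then show "R *\<^sub>R axis i 1 \<in> kite_prism i j R"
    using R ij by (simp add: kite_prism_def axis_def)
qed (simp add: inner_axis_1)

text \<open>A point where both bodies touch the hyperplane \<open>x $ j = 1\<close> belongs to every mean, and every mean
stays on the same side of that hyperplane.\<close>

lemma mean_radius_touching:
  fixes K L :: "(real ^ 'n) set"
  assumes K: "K \<in> bodies0" and L: "L \<in> bodies0"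
    and w: "w \<in> K" "w \<in> L" "axis j 1 \<bullet> w = 1"
    and le: "\<And>y. y \<in> K \<Longrightarrow> axis j 1 \<bullet> y \<le> 1" "\<And>y. y \<in> L \<Longrightarrow> axis j 1 \<bullet> y \<le> 1"
    and l: "0 \<le> l" "mean_of s p K L \<subseteq> (*\<^sub>R) l ` mean_of t q K L"
  shows "1 \<le> l"
proof -
  have "w \<in> (*\<^sub>R) 1 ` lower_mean p K L"
  proof (rule lower_mean_intro[OF K L])
    assume "w \<noteq> 0"
    then have g: "0 < gauge_fn K w" "0 < gauge_fn L w" using K L by (simp_all add: gauge_pos)
    show "pmean (- p) (gauge_fn K w) (gauge_fn L w) \<le> 1"
      using pmean_bounds(2)[OF g, of "- p"] gauge_le_one[OF w(1)] gauge_le_one[OF w(2)] by simp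
  qed simp_all
  then have "w \<in> mean_of s p K L"
    using lower_subset_upper[OF K L, of p] by (cases s) auto
  then obtain y where y: "y \<in> mean_of t q K L" "w = l *\<^sub>R y" using l(2) by blast
  then have "y \<in> upper_mean q K L"
    using lower_subset_upper[OF K L, of q] by (cases t) auto
  then have "axis j 1 \<bullet> y \<le> pmean q 1 1"
    using le by (intro upper_mean_inner_le_pmean[OF K L]) simp_all
  then have "axis j 1 \<bullet> y \<le> 1" by (simp add: pmean_same)
  then have "l * (axis j 1 \<bullet> y) \<le> l * 1" using l(1) by (rule mult_left_mono)
  then show ?thesis using w(3) by (simp add: y(2))
qed


text \<open>For \<open>p \<le> 1\<close> the quotient of the arithmetic mean and the \<open>p\<close>-mean of \<open>h\<^sub>K(a)\<close> and \<open>h\<^sub>L(a)\<close> is at most its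
value at \<open>R\<close> and \<open>1\<close>; and \<open>a \<bullet> (k + l)\<close> is at most \<open>h\<^sub>K(a) + h\<^sub>L(a)\<close>.\<close>

lemma sum_in_upper_mean_le_1:
  fixes K L :: "(real ^ 'n) set"
  assumes K: "K \<in> bodies0" and L: "L \<in> bodies0" and dist: "covering_distance K L = R"
    and "p \<le> 1" "k \<in> K" "l \<in> L"
  shows "(pmean p R 1 / (R + 1)) *\<^sub>R (k + l) \<in> upper_mean p K L"
  unfolding upper_mean_def
proof clarify
  fix a :: "real ^ 'n" assume a: "a \<in> sphere 0 1"
  let ?s = "support_fn K a" and ?t = "support_fn L a" and ?m = "pmean p R 1"
  have st: "0 < ?s" "0 < ?t" using support_pos[OF K a] support_pos[OF L a] .
  have m: "0 < ?m / (R + 1)" using pmean_dist_pos[OF K L dist, of p] dist_pos[OF K L dist] by simp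
  have "a \<bullet> (k + l) \<le> ?s + ?t"
    using support_upper[OF bodies0D(1)[OF K] assms(5), of a]
      support_upper[OF bodies0D(1)[OF L] assms(6), of a] by (simp add: inner_add_right)
  also have "(?s + ?t) / 2 \<le> pmean 1 R 1 / ?m * pmean p ?s ?t"
    using pmean_le_ratio[OF assms(4) st support_ratio[OF K L dist]] st by (simp add: pmean_one)
  then have "?s + ?t \<le> (R + 1) / ?m * pmean p ?s ?t"
    using dist_pos[OF K L dist] by (simp add: pmean_one)
  finally have "?m / (R + 1) * (a \<bullet> (k + l)) \<le> ?m / (R + 1) * ((R + 1) / ?m * pmean p ?s ?t)"
    using m by (intro mult_left_mono) simp_all
  also have "\<dots> = pmean p ?s ?t" using pmean_dist_pos[OF K L dist, of p] dist_pos[OF K L dist] by simp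
  finally show "a \<bullet> (?m / (R + 1)) *\<^sub>R (k + l) \<le> pmean p ?s ?t" by simp
qed

lemma sum_in_upper_mean_ge_1:
  fixes K L :: "(real ^ 'n) set"
  assumes K: "K \<in> bodies0" and L: "L \<in> bodies0"
    and "1 \<le> p" "k \<in> K" "l \<in> L"
  shows "(1 / 2) *\<^sub>R (k + l) \<in> upper_mean p K L"
  unfolding upper_mean_def
proof clarify
  fix a :: "real ^ 'n" assume a: "a \<in> sphere 0 1"
  let ?s = "support_fn K a" and ?t = "support_fn L a"
  have st: "0 < ?s" "0 < ?t" using support_pos[OF K a] support_pos[OF L a] .
  have "a \<bullet> (k + l) \<le> ?s + ?t"
    using support_upper[OF bodies0D(1)[OF K] assms(4), of a]
      support_upper[OF bodies0D(1)[OF L] assms(5), of a] by (simp add: inner_add_right)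
  moreover have "(?s + ?t) / 2 \<le> pmean p ?s ?t"
    using pmean_mono_exponent[OF assms(3) st] st by (simp add: pmean_one)
  ultimately show "a \<bullet> (1 / 2) *\<^sub>R (k + l) \<le> pmean p ?s ?t" by simp
qed

text \<open>The Hoelder inequality gives the easy half of the description of the upper \<open>P\<close>-mean as a union of
Minkowski combinations of \<open>K\<close> and \<open>L\<close>.\<close>

lemma combination_in_upper_mean:
  fixes K L :: "(real ^ 'n) set"
  assumes K: "K \<in> bodies0" and L: "L \<in> bodies0"
    and P: "1 < P" and uv: "0 \<le> u" "0 \<le> v" "pnorm (P / (P - 1)) u v \<le> 1" and kl: "k \<in> K" "l \<in> L"
  shows "(2 powr (- (1 / P))) *\<^sub>R (u *\<^sub>R k + v *\<^sub>R l) \<in> upper_mean (ereal P) K L"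
  unfolding upper_mean_def
proof clarify
  fix a :: "real ^ 'n" assume a: "a \<in> sphere 0 1"
  let ?s = "support_fn K a" and ?t = "support_fn L a"
  have st: "0 < ?s" "0 < ?t" using support_pos[OF K a] support_pos[OF L a] .
  have "a \<bullet> (u *\<^sub>R k + v *\<^sub>R l) \<le> u * ?s + v * ?t"
    using uv support_upper[OF bodies0D(1)[OF K] kl(1), of a]
      support_upper[OF bodies0D(1)[OF L] kl(2), of a]
    by (simp add: inner_add_right add_mono mult_left_mono)
  also have "\<dots> \<le> pnorm (P / (P - 1)) u v * pnorm P ?s ?t"
    using holder[OF conj_exponent(1)[OF P] P conj_exponent(3)[OF P]] uv st by simp
  also have "\<dots> \<le> 1 * pnorm P ?s ?t" using uv(3) by (intro mult_right_mono pnorm_nonneg)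
  finally have "2 powr (- (1 / P)) * (a \<bullet> (u *\<^sub>R k + v *\<^sub>R l))
      \<le> 2 powr (- (1 / P)) * (2 powr (1 / P) * pmean (ereal P) ?s ?t)"
    using P st by (intro mult_left_mono) (simp_all add: pnorm_pmean)
  also have "\<dots> = pmean (ereal P) ?s ?t" by (simp add: powr_minus)
  finally show "a \<bullet> (2 powr (- (1 / P))) *\<^sub>R (u *\<^sub>R k + v *\<^sub>R l) \<le> pmean (ereal P) ?s ?t"
    by simp
qed

lemma lower_mean_inner_le:
  fixes K L :: "(real ^ 'n) set"
  assumes K: "K \<in> bodies0" and L: "L \<in> bodies0"
    and "y \<in> lower_mean q K L"
    and "\<And>z. z \<noteq> 0 \<Longrightarrow> pmean (- q) (gauge_fn K z) (gauge_fn L z) = 1 \<Longrightarrow> c \<bullet> z \<le> b"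
  shows "c \<bullet> y \<le> b"
  using lower_mean_subset[OF K L convex_halfspace_le[of c b], of q] assms by auto

lemma sum_gauges_le_2:
  fixes K L :: "(real ^ 'n) set"
  assumes K: "K \<in> bodies0" and L: "L \<in> bodies0"
    and "q \<le> - 1" "z \<noteq> 0" "pmean (- q) (gauge_fn K z) (gauge_fn L z) = 1"
  shows "gauge_fn K z + gauge_fn L z \<le> 2"
proof -
  have "1 \<le> - q" using assms(3) by (cases q) (simp_all add: one_ereal_def)
  then show ?thesis
    using pmean_mono_exponent[of 1 "- q" "gauge_fn K z" "gauge_fn L z"] K L assms
    by (simp add: gauge_pos pmean_one)
qed

lemma sum_gauges_le:
  fixes K L :: "(real ^ 'n) set"
  assumes K: "K \<in> bodies0" and L: "L \<in> bodies0" and dist: "covering_distance K L = R"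
    and "- 1 \<le> q" "z \<noteq> 0" "pmean (- q) (gauge_fn K z) (gauge_fn L z) = 1"
  shows "gauge_fn K z + gauge_fn L z \<le> (R + 1) / pmean (- q) R 1"
proof -
  have "- q \<le> 1" using assms(4) by (cases q) (simp_all add: one_ereal_def)
  then show ?thesis
    using pmean_le_ratio[of "- q" 1 "gauge_fn K z" "gauge_fn L z" R] K L assms gauge_ratio[OF K L dist] dist_pos[OF K L dist]
      pmean_dist_pos[OF K L dist, of "- q"]
    by (simp add: gauge_pos pmean_one field_simps)
qed

lemma two_sided_box_gauge:
  assumes "1 \<le> R" "i \<noteq> j"
  shows "z $ i \<le> gauge_fn (two_sided_box i j R) z" "z $ j \<le> gauge_fn (uminus ` two_sided_box i j R) z"
proof -
  note B = two_sided_box_bodies0[OF assms(1), of i j]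
  have "axis i 1 \<bullet> z \<le> 1 * gauge_fn (two_sided_box i j R) z"
  proof (rule inner_le_gauge[OF B])
    fix y assume "y \<in> two_sided_box i j R"
    then have "y $ i \<le> (if i = j then R else 1)" unfolding mem_two_sided_box by blast
    then show "axis i 1 \<bullet> y \<le> 1" using assms by (simp add: inner_axis_1)
  qed
  then show "z $ i \<le> gauge_fn (two_sided_box i j R) z" by (simp add: inner_axis_1)
  have "axis j 1 \<bullet> z \<le> 1 * gauge_fn (uminus ` two_sided_box i j R) z"
  proof (rule inner_le_gauge[OF bodies0_uminus[OF B]], clarify)
    fix y assume "y \<in> two_sided_box i j R"
    then have "(if j = i then - R else - 1) \<le> y $ j" unfolding mem_two_sided_box by blast
    then show "axis j 1 \<bullet> - y \<le> 1" using assms by (simp add: inner_axis_1)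
  qed
  then show "z $ j \<le> gauge_fn (uminus ` two_sided_box i j R) z" by (simp add: inner_axis_1)
qed

lemma two_sided_box_points:
  assumes "1 \<le> R" "i \<noteq> j"
  shows "axis i 1 + R *\<^sub>R axis j 1 \<in> two_sided_box i j R"
    "R *\<^sub>R axis i 1 + axis j 1 \<in> uminus ` two_sided_box i j R"
proof -
  show "axis i 1 + R *\<^sub>R axis j 1 \<in> two_sided_box i j R"
    using assms by (simp_all add: mem_two_sided_box axis_def)
  have "- (R *\<^sub>R axis i 1 + axis j 1) \<in> two_sided_box i j R"
    using assms by (simp_all add: mem_two_sided_box axis_def)
  from imageI[OF this, of uminus]
  show "R *\<^sub>R axis i 1 + axis j 1 \<in> uminus ` two_sided_box i j R" unfolding minus_minus .
qed

text \<open>With \<open>c\<close> the sum of the two unit vectors, \<open>m\<^sub>p(R, 1) c\<close> is a multiple of \<open>k + l\<close> for \<open>k\<close> in the box and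
\<open>l\<close> in its reflection, hence in the upper mean. On the lower mean \<open>c\<close> is at most
\<open>\<parallel>z\<parallel>\<^sub>K + \<parallel>z\<parallel>\<^sub>L \<le> 2\<close>, since \<open>-q \<ge> 1\<close>, and \<open>c \<bullet> c = 2\<close>.\<close>

lemma two_sided_box_sharp:
  assumes R: "1 \<le> R" and ij: "i \<noteq> j" and pq: "p \<le> 1" "q \<le> - 1"
  defines "K \<equiv> two_sided_box i j R"
  shows "pmean p R 1 \<le> covering_radius (upper_mean p K (uminus ` K)) (lower_mean q K (uminus ` K))"
proof -
  define L where "L = uminus ` K"
  have bK: "K \<in> bodies0" and bL: "L \<in> bodies0"
    using two_sided_box_bodies0[OF R, of i j] bodies0_uminus by (simp_all add: K_def L_def)
  have bR: "covering_distance K L = R"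
    using covering_distance_two_sided_box[OF R ij] by (simp add: L_def K_def)
  let ?c = "axis i 1 + axis j 1 :: real ^ 'a"
  let ?m = "pmean p R 1"
  show ?thesis unfolding L_def[symmetric]
  proof (rule upper_lower_radius_ge[OF bK bL])
    fix l assume l: "0 \<le> l" "upper_mean p K L \<subseteq> (*\<^sub>R) l ` lower_mean q K L"
    have "(?m / (R + 1)) *\<^sub>R ((axis i 1 + R *\<^sub>R axis j 1) + (R *\<^sub>R axis i 1 + axis j 1))
        \<in> upper_mean p K L"
      using sum_in_upper_mean_le_1[OF bK bL bR pq(1)] two_sided_box_points[OF R ij] bR
      by (simp add: K_def L_def)
    also have "(axis i 1 + R *\<^sub>R axis j 1) + (R *\<^sub>R axis i 1 + axis j 1) = (R + 1) *\<^sub>R ?c"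
      by (simp add: algebra_simps)
    finally have "?m *\<^sub>R ?c \<in> upper_mean p K L" using R by simp
    then obtain y where y: "y \<in> lower_mean q K L" "?m *\<^sub>R ?c = l *\<^sub>R y" using l(2) by blast
    have "?c \<bullet> y \<le> 2"
    proof (rule lower_mean_inner_le[OF bK bL y(1)])
      fix z assume "z \<noteq> 0" "pmean (- q) (gauge_fn K z) (gauge_fn L z) = 1"
      then have "gauge_fn K z + gauge_fn L z \<le> 2" by (rule sum_gauges_le_2[OF bK bL pq(2)])
      then show "?c \<bullet> z \<le> 2"
        using two_sided_box_gauge[OF R ij, of z] by (simp add: K_def L_def inner_add_left inner_axis_1)
    qed
    then have "l * (?c \<bullet> y) \<le> l * 2" using l(1) by (rule mult_left_mono)
    moreover have "?c \<bullet> (?m *\<^sub>R ?c) = ?m * 2"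
      using ij by (simp add: inner_add_left inner_axis_1 axis_1_nth)
    ultimately show "?m \<le> l" by (simp add: y(2))
  qed
qed

text \<open>The combinations of the points \<open>(1, R)\<close> and \<open>(R, 1)\<close> with coefficients of norm at most \<open>1\<close> lie in
a multiple of the upper mean, and they are the images of these coefficients under the matrix. On the
lower mean, a functional with nonnegative coefficients of dual norm at most \<open>1\<close> is bounded by the
norm of the two gauges, which is constant on the generators; the coefficients are chosen extremal
for the image vector.\<close>

lemma two_sided_box_matrix_sharp:
  assumes R: "1 \<le> R" and ij: "i \<noteq> j" and PQ: "1 < P" "Q < - 1"
  defines "K \<equiv> two_sided_box i j R"
  shows "matrix_bound P Q R
    \<le> covering_radius (upper_mean (ereal P) K (uminus ` K)) (lower_mean (ereal Q) K (uminus ` K))"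
proof -
  define L where "L = uminus ` K"
  have bK: "K \<in> bodies0" and bL: "L \<in> bodies0"
    using two_sided_box_bodies0[OF R, of i j] bodies0_uminus by (simp_all add: K_def L_def)
  define s where "s = - Q"
  have s: "1 < s" using PQ by (simp add: s_def)
  note s' = conj_exponent[OF s]
  show ?thesis unfolding L_def[symmetric]
  proof (rule upper_lower_radius_ge[OF bK bL])
    fix l assume l: "0 \<le> l" "upper_mean (ereal P) K L \<subseteq> (*\<^sub>R) l ` lower_mean (ereal Q) K L"
    have key: "2 powr (1 / Q - 1 / P) * pnorm s (R * x + y) (x + R * y) \<le> l"
      if xy: "0 \<le> x" "0 \<le> y" "pnorm (P / (P - 1)) x y \<le> 1" for x y
    proof -
      define w :: "real ^ 'a" where
        "w = y *\<^sub>R (axis i 1 + R *\<^sub>R axis j 1) + x *\<^sub>R (R *\<^sub>R axis i 1 + axis j 1)"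
      have wi: "w $ i = R * x + y" "w $ j = x + R * y" using ij by (simp_all add: w_def axis_def)
      have "(2 powr (- (1 / P))) *\<^sub>R w \<in> upper_mean (ereal P) K L"
        unfolding w_def using xy two_sided_box_points[OF R ij]
        by (intro combination_in_upper_mean[OF bK bL PQ(1)]) (simp_all add: K_def L_def pnorm_commute)
      then obtain z where z: "z \<in> lower_mean (ereal Q) K L" "(2 powr (- (1 / P))) *\<^sub>R w = l *\<^sub>R z"
        using l(2) by blast
      have nn: "0 \<le> R * x + y" "0 \<le> x + R * y" using R xy by simp_all
      obtain \<alpha> \<beta> where ab: "0 \<le> \<alpha>" "0 \<le> \<beta>" "pnorm (s / (s - 1)) \<alpha> \<beta> \<le> 1"
        "\<alpha> * (R * x + y) + \<beta> * (x + R * y) = pnorm s (R * x + y) (x + R * y)"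
        using holder_attained[OF s'(1) s s'(3) nn] by auto
      let ?c = "\<alpha> *\<^sub>R axis i 1 + \<beta> *\<^sub>R axis j 1 :: real ^ 'a"
      have "?c \<bullet> z \<le> 2 powr (1 / s)"
      proof (rule lower_mean_inner_le[OF bK bL z(1)])
        fix d assume d: "d \<noteq> 0" "pmean (- ereal Q) (gauge_fn K d) (gauge_fn L d) = 1"
        have g: "0 < gauge_fn K d" "0 < gauge_fn L d"
          using gauge_pos[OF bK d(1)] gauge_pos[OF bL d(1)] .
        have "?c \<bullet> d = \<alpha> * d $ i + \<beta> * d $ j" by (simp add: inner_add_left inner_axis_1)
        also have "\<dots> \<le> \<alpha> * gauge_fn K d + \<beta> * gauge_fn L d"
          using two_sided_box_gauge[OF R ij, of d] ab(1,2)
          by (intro add_mono mult_left_mono) (simp_all add: K_def L_def)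
        also have "\<dots> \<le> pnorm (s / (s - 1)) \<alpha> \<beta> * pnorm s (gauge_fn K d) (gauge_fn L d)"
          using ab g by (intro holder[OF s'(1) s s'(3)]) simp_all
        also have "\<dots> \<le> 1 * pnorm s (gauge_fn K d) (gauge_fn L d)"
          using ab(3) by (intro mult_right_mono pnorm_nonneg)
        also have "\<dots> = 2 powr (1 / s)" using d(2) s g by (simp add: pnorm_pmean s_def)
        finally show "?c \<bullet> d \<le> 2 powr (1 / s)" .
      qed
      then have "l * (?c \<bullet> z) \<le> l * 2 powr (1 / s)" using l(1) by (rule mult_left_mono)
      moreover have "l * (?c \<bullet> z) = ?c \<bullet> ((2 powr (- (1 / P))) *\<^sub>R w)" by (simp add: z(2))
      moreover have "?c \<bullet> ((2 powr (- (1 / P))) *\<^sub>R w)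
          = 2 powr (- (1 / P)) * pnorm s (R * x + y) (x + R * y)"
        using ab(4) wi by (simp add: inner_add_left inner_axis_1 algebra_simps)
      ultimately have "2 powr (- (1 / s)) * (2 powr (- (1 / P)) * pnorm s (R * x + y) (x + R * y))
          \<le> 2 powr (- (1 / s)) * (l * 2 powr (1 / s))"
        by (intro mult_left_mono) simp_all
      also have "\<dots> = l" by (simp add: powr_minus)
      finally show ?thesis by (simp add: s_def flip: powr_add mult.assoc)
    qed
    \<comment> \<open>Only \<open>l \<ge> 0\<close> is known so far; the first unit vector shows that \<open>l\<close> is positive.\<close>
    have "pnorm (P / (P - 1)) 1 0 \<le> 1" using PQ by (simp add: pnorm_axis)
    then have "2 powr (1 / Q - 1 / P) * pnorm s (R * 1 + 0) (1 + R * 0) \<le> l" by (intro key) simp_all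
    moreover have "0 < pnorm s (R * 1 + 0) (1 + R * 0)" using R s by (simp add: pnorm_pmean pmean_pos)
    ultimately have "0 < l" by (metis less_le_trans mult_pos_pos powr_gt_zero zero_neq_numeral)
    then show "matrix_bound P Q R \<le> l" using key R PQ by (intro matrix_bound_le) (simp_all add: s_def)
  qed
qed

text \<open>The two facet inequalities with normals \<open>(1, R)\<close> and \<open>(R, 1)\<close> add up to
\<open>(R + 1) (z $ i + z $ j) \<le> R (\<parallel>z\<parallel>\<^sub>K + \<parallel>z\<parallel>\<^sub>L)\<close>. As \<open>-q \<le> 1\<close>, the right-hand side is at most
\<open>R (R + 1) / m\<^sub>-\<^sub>q(R, 1)\<close> on the generators of the lower mean, whereas the coordinate sum equals \<open>R\<close> at the
midpoint of the vertices \<open>(R, 0)\<close> of the kite and \<open>(0, R)\<close> of its reflection, a point of the upper mean.\<close>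

lemma kite_prism_sharp:
  assumes R: "1 \<le> R" and ij: "i \<noteq> j" and pq: "1 \<le> p" "- 1 \<le> q"
  defines "K \<equiv> kite_prism i j R"
  shows "pmean (- q) R 1 \<le> covering_radius (upper_mean p K (uminus ` K)) (lower_mean q K (uminus ` K))"
proof -
  define L where "L = uminus ` K"
  have bK: "K \<in> bodies0" and bL: "L \<in> bodies0"
    using kite_prism_bodies0[OF R, of i j] bodies0_uminus by (simp_all add: K_def L_def)
  have bR: "covering_distance K L = R"
    using covering_distance_kite_prism[OF R ij] by (simp add: L_def K_def)
  let ?c = "axis i 1 + axis j 1 :: real ^ 'a"
  let ?m = "pmean (- q) R 1"
  have m: "0 < ?m" using R by (simp add: pmean_pos)
  have pts: "R *\<^sub>R axis i 1 \<in> K" "R *\<^sub>R axis j 1 \<in> L"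
  proof -
    have RR: "- (R * R) \<le> R" using R zero_le_square[of R] by linarith
    then show "R *\<^sub>R axis i 1 \<in> K" using R ij by (simp add: K_def kite_prism_def axis_def)
    have "- (R *\<^sub>R axis j 1) \<in> K" using R ij RR by (simp add: K_def kite_prism_def axis_def)
    from imageI[OF this, of uminus] show "R *\<^sub>R axis j 1 \<in> L" by (simp add: L_def)
  qed
  have g1: "z $ i + R * z $ j \<le> R * gauge_fn K z" for z
    using inner_le_gauge[OF bK, of "axis i 1 + R *\<^sub>R axis j 1" R z]
    by (simp add: inner_add_left inner_axis_1 K_def kite_prism_def)
  have g2: "R * z $ i + z $ j \<le> R * gauge_fn L z" for z
  proof -
    have "(R *\<^sub>R axis i 1 + axis j 1) \<bullet> y \<le> R" if "y \<in> L" for y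
      using that by (auto simp: inner_add_left inner_axis_1 L_def K_def kite_prism_def)
    from inner_le_gauge[OF bL this, of z] show ?thesis by (simp add: inner_add_left inner_axis_1)
  qed
  show ?thesis unfolding L_def[symmetric]
  proof (rule upper_lower_radius_ge[OF bK bL])
    fix l assume l: "0 \<le> l" "upper_mean p K L \<subseteq> (*\<^sub>R) l ` lower_mean q K L"
    have "(1 / 2) *\<^sub>R (R *\<^sub>R axis i 1 + R *\<^sub>R axis j 1) \<in> upper_mean p K L"
      by (rule sum_in_upper_mean_ge_1[OF bK bL pq(1) pts])
    then have "(R / 2) *\<^sub>R ?c \<in> upper_mean p K L" by (simp add: scaleR_add_right)
    then obtain y where y: "y \<in> lower_mean q K L" "(R / 2) *\<^sub>R ?c = l *\<^sub>R y" using l(2) by blast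
    have "?c \<bullet> y \<le> R / ?m"
    proof (rule lower_mean_inner_le[OF bK bL y(1)])
      fix z assume "z \<noteq> 0" "pmean (- q) (gauge_fn K z) (gauge_fn L z) = 1"
      then have "gauge_fn K z + gauge_fn L z \<le> (R + 1) / ?m"
        using sum_gauges_le[OF bK bL bR pq(2)] bR by simp
      then have "R * (gauge_fn K z + gauge_fn L z) \<le> R * ((R + 1) / ?m)"
        using R by (intro mult_left_mono) simp_all
      then have "(R + 1) * (?c \<bullet> z) \<le> (R + 1) * (R / ?m)"
        using g1[of z] g2[of z] by (simp add: inner_add_left inner_axis_1 algebra_simps)
      then show "?c \<bullet> z \<le> R / ?m" using R by (simp only: mult_le_cancel_left_pos)
    qed
    then have "l * (?c \<bullet> y) \<le> l * (R / ?m)" using l(1) by (rule mult_left_mono)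
    moreover have "l * (?c \<bullet> y) = ?c \<bullet> ((R / 2) *\<^sub>R ?c)" by (simp add: y(2))
    moreover have "?c \<bullet> ((R / 2) *\<^sub>R ?c) = R"
      using ij by (simp add: inner_add_left inner_axis_1 axis_1_nth)
    ultimately have "R \<le> l * (R / ?m)" by linarith
    then have "R * ?m \<le> R * l" using m by (simp add: field_simps)
    then show "?m \<le> l" using R by simp
  qed
qed

lemma one_sided_box_touching:
  assumes R: "1 \<le> R" and ij: "i \<noteq> j"
  defines "K \<equiv> one_sided_box i R"
  assumes l: "0 \<le> l" "mean_of s p K (uminus ` K) \<subseteq> (*\<^sub>R) l ` mean_of t q K (uminus ` K)"
  shows "1 \<le> l"
proof (rule mean_radius_touching[OF _ _ _ _ _ _ _ l])
  show K: "K \<in> bodies0" "uminus ` K \<in> bodies0"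
    using one_sided_box_bodies0[OF R, of i] bodies0_uminus by (simp_all add: K_def)
  have mem: "axis j 1 \<in> K" "- axis j 1 \<in> K"
    using R ij by (simp_all add: K_def mem_one_sided_box axis_def)
  then show "axis j 1 \<in> K" by simp
  show "axis j 1 \<in> uminus ` K" using imageI[OF mem(2), of uminus] by simp
  show "axis j 1 \<bullet> (axis j 1 :: real ^ 'a) = 1" by (simp add: inner_axis_1 axis_1_nth)
  show "axis j 1 \<bullet> y \<le> 1" if "y \<in> K" for y
    using that R by (simp add: K_def mem_one_sided_box inner_axis_1)
  show "axis j 1 \<bullet> y \<le> 1" if "y \<in> uminus ` K" for y
    using that R ij by (auto simp: K_def mem_one_sided_box inner_axis_1 split: if_splits)
qed

section \<open>The theorem\<close>

lemma pmean_ge_1: "1 \<le> R \<Longrightarrow> 1 \<le> pmean p R 1"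
  using pmean_mono[of 1 1 R 1 p] by (simp add: pmean_same)

lemma exponent_cases:
  fixes p q :: ereal
  assumes "(p, q) \<notin> {1<..<\<infinity>} \<times> {-\<infinity><..<-1}" "(p, q) \<notin> {-\<infinity><..<1} \<times> {-1<..<\<infinity>}"
  obtains (mean_le) "p \<le> 1" "q \<le> - 1" | (mean_ge) "1 \<le> p" "- 1 \<le> q"
    | (p_top) "p = \<infinity>" | (q_bot) "q = -\<infinity>" | (p_bot) "p = -\<infinity>" | (q_top) "q = \<infinity>"
proof -
  consider "p = \<infinity>" | "p = -\<infinity>" | "q = \<infinity>" | "q = -\<infinity>"
    | (finite) "p \<noteq> \<infinity>" "p \<noteq> -\<infinity>" "q \<noteq> \<infinity>" "q \<noteq> -\<infinity>" by blast
  then show ?thesis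
  proof cases
    case finite
    then obtain a b where ab: "p = ereal a" "q = ereal b" by (cases p; cases q) simp_all
    then have "\<not> (1 < a \<and> b < - 1)" "\<not> (a < 1 \<and> - 1 < b)"
      using assms by (simp_all add: one_ereal_def)
    then consider "a \<le> 1" "b \<le> - 1" | "1 \<le> a" "- 1 \<le> b" by linarith
    then show ?thesis using that(1,2) ab by cases (simp_all add: one_ereal_def)
  qed (use that in blast)+
qed

text \<open>If \<open>p = \<infinity>\<close> or \<open>q = -\<infinity>\<close>, the claimed minimum is at most the quotient \<open>m\<^sub>p(R, 1) / m\<^sub>q(R, 1)\<close> that bounds
the radius from below for any two kinds of means. If \<open>p = -\<infinity>\<close> or \<open>q = \<infinity>\<close>, the minimum is \<open>1\<close>.\<close>

lemma upper_lower_radius_sharp: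
  fixes p q :: ereal
  assumes R: "1 \<le> R" and ij: "i \<noteq> (j :: 'n :: finite)"
    and pq: "(p, q) \<notin> {1<..<\<infinity>} \<times> {-\<infinity><..<-1}" "(p, q) \<notin> {-\<infinity><..<1} \<times> {-1<..<\<infinity>}"
  shows "\<exists>K \<in> (bodies0 :: (real ^ 'n) set set). R = covering_distance K (uminus ` K)
    \<and> covering_radius (upper_mean p K (uminus ` K)) (lower_mean q K (uminus ` K))
        = min (pmean p R 1) (pmean (- q) R 1)"
proof -
  have upper: "covering_radius (upper_mean p K (uminus ` K)) (lower_mean q K (uminus ` K))
      \<le> min (pmean p R 1) (pmean (- q) R 1)"
    if "K \<in> bodies0" "covering_distance K (uminus ` K) = R" for K :: "(real ^ 'n) set"
    using upper_lower_radius_le[OF that(1) bodies0_uminus[OF that(1)] that(2)] .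
  have exact: ?thesis
    if K: "K \<in> bodies0" "covering_distance K (uminus ` K) = R"
      and ge: "min (pmean p R 1) (pmean (- q) R 1)
        \<le> covering_radius (upper_mean p K (uminus ` K)) (lower_mean q K (uminus ` K))"
    for K :: "(real ^ 'n) set"
    using that upper[OF K] by (intro bexI[of _ K]) simp_all
  note two = two_sided_box_bodies0[OF R, of i j] covering_distance_two_sided_box[OF R ij]
  note one = one_sided_box_bodies0[OF R, of i] covering_distance_one_sided_box[OF R, of i]
  note kite = kite_prism_bodies0[OF R, of i j] covering_distance_kite_prism[OF R ij]
  have ratio: "pmean p R 1 / pmean q R 1 \<le> covering_radius (upper_mean p K (uminus ` K)) (lower_mean q K (uminus ` K))"
    if K: "K = two_sided_box i j R" for K
  proof -
    have bK: "K \<in> bodies0" and bR: "covering_distance K (uminus ` K) = R"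
      using two by (simp_all add: K)
    note bL = bodies0_uminus[OF bK]
    then show ?thesis using mean_radius_ge[OF bK bL bR, of _ Upper p Lower q]
      by (intro upper_lower_radius_ge[OF bK bL]) simp
  qed
  have touching: "1 \<le> covering_radius (upper_mean p K (uminus ` K)) (lower_mean q K (uminus ` K))"
    if K: "K = one_sided_box i R" for K
  proof -
    have bK: "K \<in> bodies0" using one by (simp add: K)
    note bL = bodies0_uminus[OF bK]
    show ?thesis using one_sided_box_touching[OF R ij, of _ Upper p Lower q] K
      by (intro upper_lower_radius_ge[OF bK bL]) simp
  qed
  show ?thesis
    using pq
  proof (cases rule: exponent_cases)
    case mean_le
    then show ?thesis using two_sided_box_sharp[OF R ij, of p q] by (intro exact[OF two]) simp
  next
    case mean_ge
    then show ?thesis using kite_prism_sharp[OF R ij, of p q] by (intro exact[OF kite]) simp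
  next
    case p_top
    then show ?thesis using ratio R by (intro exact[OF two]) (simp add: pmean_uminus_R)
  next
    case q_bot
    then show ?thesis using ratio R by (intro exact[OF two]) simp
  next
    case p_bot
    then show ?thesis using touching pmean_ge_1[OF R, of "- q"] R
      by (intro exact[OF one]) simp
  next
    case q_top
    then show ?thesis using touching pmean_ge_1[OF R, of p] R
      by (intro exact[OF one]) simp
  qed
qed

lemma obtain_distinct_indices:
  assumes "2 \<le> CARD('n :: finite)"
  obtains i j :: "'n :: finite" where "i \<noteq> j"
proof -
  have "\<not> card (UNIV :: 'n set) \<le> Suc 0" using assms by simp
  then show ?thesis using that card_le_Suc0_iff_eq[of "UNIV :: 'n set"] by auto
qed

theorem theorem1p6:
  fixes p q :: ereal
  shows
   "(\<forall>K \<in> (bodies0 :: (real ^ 'n) set set). \<forall>L \<in> bodies0.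
      (\<forall>s t. (s, t) \<noteq> (Upper, Lower) \<and> p \<ge> q \<longrightarrow>
         covering_radius (mean_of s p K L) (mean_of t q K L)
           = pmean p (covering_distance K L) 1 / pmean q (covering_distance K L) 1)
    \<and> (\<forall>s t. (s, t) \<noteq> (Upper, Lower) \<and> p < q \<longrightarrow>
         covering_radius (mean_of s p K L) (mean_of t q K L) \<le> 1)
    \<and> ((p, q) \<notin> {1<..<\<infinity>} \<times> {-\<infinity><..<-1} \<longrightarrow>
         covering_radius (upper_mean p K L) (lower_mean q K L)
           \<le> min (pmean p (covering_distance K L) 1) (pmean (- q) (covering_distance K L) 1))
    \<and> (\<forall>P Q :: real. p = ereal P \<and> q = ereal Q \<and> 1 < P \<and> Q < -1 \<longrightarrow>
         covering_radius (upper_mean p K L) (lower_mean q K L)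
           \<le> matrix_bound P Q (covering_distance K L)
       \<and> (P / (P - 1) \<ge> - Q \<longrightarrow>
            matrix_bound P Q (covering_distance K L) = pmean 1 (covering_distance K L) 1
          \<and> pmean 1 (covering_distance K L) 1 = (covering_distance K L + 1) / 2)))
  \<and> (CARD('n) \<ge> 2 \<longrightarrow> (\<forall>R :: real. R \<ge> 1 \<longrightarrow>
      (\<forall>s t. (s, t) \<noteq> (Upper, Lower) \<and> p \<ge> q \<longrightarrow>
         (\<exists>K \<in> (bodies0 :: (real ^ 'n) set set).
            R = covering_distance K (uminus ` K)
          \<and> covering_radius (mean_of s p K (uminus ` K)) (mean_of t q K (uminus ` K))
              = pmean p R 1 / pmean q R 1))
    \<and> (\<forall>s t. (s, t) \<noteq> (Upper, Lower) \<and> p < q \<longrightarrow>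
         (\<exists>K \<in> (bodies0 :: (real ^ 'n) set set).
            R = covering_distance K (uminus ` K)
          \<and> covering_radius (mean_of s p K (uminus ` K)) (mean_of t q K (uminus ` K)) = 1))
    \<and> ((p, q) \<notin> {1<..<\<infinity>} \<times> {-\<infinity><..<-1} \<and> (p, q) \<notin> {-\<infinity><..<1} \<times> {-1<..<\<infinity>} \<longrightarrow>
         (\<exists>K \<in> (bodies0 :: (real ^ 'n) set set).
            R = covering_distance K (uminus ` K)
          \<and> covering_radius (upper_mean p K (uminus ` K)) (lower_mean q K (uminus ` K))
              = min (pmean p R 1) (pmean (- q) R 1)))
    \<and> (\<forall>P Q :: real. p = ereal P \<and> q = ereal Q \<and> 1 < P \<and> Q < -1 \<longrightarrow>
         (\<exists>K \<in> (bodies0 :: (real ^ 'n) set set).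
            R = covering_distance K (uminus ` K)
          \<and> covering_radius (upper_mean p K (uminus ` K)) (lower_mean q K (uminus ` K))
              = matrix_bound P Q R))))"
  (is "?bounds \<and> ?sharp")
proof
  show ?bounds
  proof (intro ballI)
    fix K L :: "(real ^ 'n) set"
    assume "K \<in> bodies0" "L \<in> bodies0"
    note bK = \<open>K \<in> bodies0\<close> and bL = \<open>L \<in> bodies0\<close> and bR = refl[of "covering_distance K L"]
    show "(\<forall>s t. (s, t) \<noteq> (Upper, Lower) \<and> p \<ge> q \<longrightarrow>
         covering_radius (mean_of s p K L) (mean_of t q K L)
           = pmean p (covering_distance K L) 1 / pmean q (covering_distance K L) 1)
    \<and> (\<forall>s t. (s, t) \<noteq> (Upper, Lower) \<and> p < q \<longrightarrow>
         covering_radius (mean_of s p K L) (mean_of t q K L) \<le> 1)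
    \<and> ((p, q) \<notin> {1<..<\<infinity>} \<times> {-\<infinity><..<-1} \<longrightarrow>
         covering_radius (upper_mean p K L) (lower_mean q K L)
           \<le> min (pmean p (covering_distance K L) 1) (pmean (- q) (covering_distance K L) 1))
    \<and> (\<forall>P Q :: real. p = ereal P \<and> q = ereal Q \<and> 1 < P \<and> Q < -1 \<longrightarrow>
         covering_radius (upper_mean p K L) (lower_mean q K L)
           \<le> matrix_bound P Q (covering_distance K L)
       \<and> (P / (P - 1) \<ge> - Q \<longrightarrow>
            matrix_bound P Q (covering_distance K L) = pmean 1 (covering_distance K L) 1
          \<and> pmean 1 (covering_distance K L) 1 = (covering_distance K L + 1) / 2))"
      using upper_lower_radius_le[OF bK bL bR, of p q]
      by (intro conjI allI impI mean_radius_eq[OF bK bL bR] mean_radius_le_one[OF bK bL])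
        (auto simp: pmean_one dist_pos[OF bK bL bR] matrix_bound_eq upper_lower_radius_le_matrix_bound[OF bK bL bR])
  qed
  show ?sharp
  proof (intro impI allI)
    fix R :: real assume "CARD('n) \<ge> 2" and R: "R \<ge> 1"
    then obtain i j :: 'n where ij: "i \<noteq> j" using obtain_distinct_indices by blast
    define B where "B = one_sided_box i R"
    define D where "D = two_sided_box i j R"
    have B: "B \<in> bodies0" "covering_distance B (uminus ` B) = R"
      unfolding B_def using one_sided_box_bodies0[OF R] covering_distance_one_sided_box[OF R] by simp_all
    have D: "D \<in> bodies0" "covering_distance D (uminus ` D) = R"
      unfolding D_def using two_sided_box_bodies0[OF R] covering_distance_two_sided_box[OF R ij] by simp_all
    note BL = bodies0_uminus[OF B(1)] and DL = bodies0_uminus[OF D(1)]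
    have "\<exists>K \<in> (bodies0 :: (real ^ 'n) set set). R = covering_distance K (uminus ` K)
          \<and> covering_radius (mean_of s p K (uminus ` K)) (mean_of t q K (uminus ` K))
              = pmean p R 1 / pmean q R 1" if "(s, t) \<noteq> (Upper, Lower) \<and> q \<le> p" for s t
      using that B mean_radius_eq[OF B(1) BL B(2), of s t q p] by (intro bexI[of _ B]) simp_all
    moreover have "\<exists>K \<in> (bodies0 :: (real ^ 'n) set set). R = covering_distance K (uminus ` K)
          \<and> covering_radius (mean_of s p K (uminus ` K)) (mean_of t q K (uminus ` K)) = 1"
      if st: "(s, t) \<noteq> (Upper, Lower) \<and> p < q" for s t
    proof -
      have "mean_of s p B (uminus ` B) \<subseteq> (*\<^sub>R) 1 ` mean_of t q B (uminus ` B)"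
        using mean_mono[OF B(1) BL, of s t p q] st less_imp_le[of p q] by simp
      moreover have "1 \<le> l" if "0 \<le> l" "mean_of s p B (uminus ` B) \<subseteq> (*\<^sub>R) l ` mean_of t q B (uminus ` B)" for l
        using one_sided_box_touching[OF R ij that[unfolded B_def]] .
      ultimately have "covering_radius (mean_of s p B (uminus ` B)) (mean_of t q B (uminus ` B)) = 1"
        by (intro covering_radius_eq) simp_all
      with B show ?thesis by (intro bexI[of _ B]) simp_all
    qed
    moreover note upper_lower_radius_sharp[OF R ij, of p q]
    moreover have "\<exists>K \<in> (bodies0 :: (real ^ 'n) set set). R = covering_distance K (uminus ` K)
          \<and> covering_radius (upper_mean p K (uminus ` K)) (lower_mean q K (uminus ` K))
              = matrix_bound P Q R" if "p = ereal P \<and> q = ereal Q \<and> 1 < P \<and> Q < -1" for P Q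
      using that D upper_lower_radius_le_matrix_bound[OF D(1) DL D(2), of P Q]
        two_sided_box_matrix_sharp[OF R ij, of P Q]
      by (intro bexI[of _ D]) (auto simp: D_def intro: antisym)
    ultimately show "(\<forall>s t. (s, t) \<noteq> (Upper, Lower) \<and> p \<ge> q \<longrightarrow>
         (\<exists>K \<in> (bodies0 :: (real ^ 'n) set set).
            R = covering_distance K (uminus ` K)
          \<and> covering_radius (mean_of s p K (uminus ` K)) (mean_of t q K (uminus ` K))
              = pmean p R 1 / pmean q R 1))
    \<and> (\<forall>s t. (s, t) \<noteq> (Upper, Lower) \<and> p < q \<longrightarrow>
         (\<exists>K \<in> (bodies0 :: (real ^ 'n) set set).
            R = covering_distance K (uminus ` K)
          \<and> covering_radius (mean_of s p K (uminus ` K)) (mean_of t q K (uminus ` K)) = 1))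
    \<and> ((p, q) \<notin> {1<..<\<infinity>} \<times> {-\<infinity><..<-1} \<and> (p, q) \<notin> {-\<infinity><..<1} \<times> {-1<..<\<infinity>} \<longrightarrow>
         (\<exists>K \<in> (bodies0 :: (real ^ 'n) set set).
            R = covering_distance K (uminus ` K)
          \<and> covering_radius (upper_mean p K (uminus ` K)) (lower_mean q K (uminus ` K))
              = min (pmean p R 1) (pmean (- q) R 1)))
    \<and> (\<forall>P Q :: real. p = ereal P \<and> q = ereal Q \<and> 1 < P \<and> Q < -1 \<longrightarrow>
         (\<exists>K \<in> (bodies0 :: (real ^ 'n) set set).
            R = covering_distance K (uminus ` K)
          \<and> covering_radius (upper_mean p K (uminus ` K)) (lower_mean q K (uminus ` K))
              = matrix_bound P Q R))"
      by (intro conjI allI impI) blast+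
  qed
qed

end
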